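(* A copula $C$ is a generalized shuffle of Min if and only if $\|C\|=1$.
   Context: A (bivariate) copula is a function $C\colon[0,1]^2\to[0,1]$ with $C(u,0)=0=C(0,v)$, $C(u,1)=u$, $C(1,v)=v$ and $C(u,v)-C(u,y)-C(x,v)+C(x,y)\ge 0$ whenever $x\le u$, $y\le v$. It induces a Borel measure $\mu_C$ on $[0,1]^2$ with $\mu_C([x,u]\times[y,v])=C(u,v)-C(u,y)-C(x,v)+C(x,y)$ (extended to its completion where needed). The Sobolev norm is $\|C\|^2=\int_0^1\int_0^1\big((\partial_1C(x,y))^2+(\partial_2C(x,y))^2\big)\,dx\,dy$. A measurable function $T\colon[0,1]\to[0,1]$ is measure-preserving if $m(T^{-1}(B))=m(B)$ for every Lebesgue measurable $B\subseteq[0,1]$, $m$ being Lebesgue measure. For $T\colon[0,1]\to[0,1]$, let $S_T(u,v)=(T(u),v)$ and let $S_T*\mu$ denote the push-forward $(S_T*\mu)(A)=\mu(S_T^{-1}(A))$. With $M(x,y)=\min(x,y)$, a copula $C$ is a generalized shuffle of Min if $\mu_C=S_T*\mu_M$ for some measure-preserving bijection $T\colon[0,1]\to[0,1]$. *)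

theory Defs
  imports "HOL-Analysis.Analysis"
begin

abbreviation unit_square :: "(real \<times> real) set" where
  "unit_square \<equiv> {0..1} \<times> {0..1}"

text \<open>
  Copulas are total functions \<open>real \<Rightarrow> real \<Rightarrow> real\<close>; values outside the unit square are
  unconstrained, and no definition below depends on them.
\<close>

definition is_copula :: "(real \<Rightarrow> real \<Rightarrow> real) \<Rightarrow> bool" where
  "is_copula C \<longleftrightarrow>
     (\<forall>u\<in>{0..1}. \<forall>v\<in>{0..1}. C u v \<in> {0..1}) \<and>
     (\<forall>u\<in>{0..1}. C u 0 = 0) \<and> (\<forall>v\<in>{0..1}. C 0 v = 0) \<and>
     (\<forall>u\<in>{0..1}. C u 1 = u) \<and> (\<forall>v\<in>{0..1}. C 1 v = v) \<and>
     (\<forall>x\<in>{0..1}. \<forall>u\<in>{0..1}. \<forall>y\<in>{0..1}. \<forall>v\<in>{0..1}. x \<le> u \<longrightarrow> y \<le> v \<longrightarrow>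
        C u v - C u y - C x v + C x y \<ge> 0)"

text \<open>
  The Borel measure on the unit square whose value on \<open>{x..u} \<times> {y..v}\<close> is the \<open>C\<close>-volume of that
  rectangle; it is the two-dimensional analogue of \<^const>\<open>interval_measure\<close>.
\<close>

definition copula_measure :: "(real \<Rightarrow> real \<Rightarrow> real) \<Rightarrow> (real \<times> real) measure" where
  "copula_measure C =
     extend_measure unit_square
       {(x, u, y, v). 0 \<le> x \<and> x \<le> u \<and> u \<le> 1 \<and> 0 \<le> y \<and> y \<le> v \<and> v \<le> 1}
       (\<lambda>(x, u, y, v). {x..u} \<times> {y..v})
       (\<lambda>(x, u, y, v). ennreal (C u v - C u y - C x v + C x y))"

lemma sets_copula_measure: "sets (copula_measure C) = sets (restrict_space borel unit_square)"
proof -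
  let ?I = "{(x::real, u, y::real, v). 0 \<le> x \<and> x \<le> u \<and> u \<le> 1 \<and> 0 \<le> y \<and> y \<le> v \<and> v \<le> 1}"
  let ?G = "\<lambda>(x::real, u, y::real, v). {x..u} \<times> {y..v}"
  have sub: "?G ` ?I \<subseteq> Pow unit_square" by auto
  have 1: "sets (copula_measure C) = sigma_sets unit_square (?G ` ?I)"
    unfolding copula_measure_def using sub by (rule sets_extend_measure)
  have "sets (restrict_space borel unit_square) = (\<inter>) unit_square ` sets borel"
    by (rule sets_restrict_space)
  also have "sets (borel :: (real \<times> real) measure) = sigma_sets UNIV (range (\<lambda>(a, b). cbox a b))"
    by (simp add: borel_eq_atLeastAtMost flip: interval_cbox)
  also have "(\<inter>) unit_square ` \<dots> =
      sigma_sets unit_square ((\<inter>) unit_square ` range (\<lambda>(a, b). cbox a b))"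
  proof (rule sigma_sets_Int)
    have "unit_square \<in> range (\<lambda>(a, b). cbox a b)"
      by (intro image_eqI[where x = "((0, 0), (1, 1))"]) (auto simp: cbox_Pair_eq)
    then show "unit_square \<in> sigma_sets UNIV (range (\<lambda>(a, b). cbox a b))"
      by (rule sigma_sets.Basic)
  qed (rule subset_UNIV)
  finally have 2: "sets (restrict_space borel unit_square) =
      sigma_sets unit_square ((\<inter>) unit_square ` range (\<lambda>(a, b). cbox a b))" .
  show ?thesis unfolding 1 2
  proof (rule sigma_sets_eqI)
    fix A assume "A \<in> ?G ` ?I"
    then obtain x u y v where A: "A = {x..u} \<times> {y..v}"
      and "0 \<le> x" "x \<le> u" "u \<le> 1" "0 \<le> y" "y \<le> v" "v \<le> 1" by auto
    then have "A = unit_square \<inter> (\<lambda>(a, b). cbox a b) ((x, y), (u, v))"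
      by (auto simp: cbox_Pair_eq)
    then have "A \<in> (\<inter>) unit_square ` range (\<lambda>(a, b). cbox a b)"
      by (rule image_eqI) (rule rangeI)
    then show "A \<in> sigma_sets unit_square ((\<inter>) unit_square ` range (\<lambda>(a, b). cbox a b))"
      by (rule sigma_sets.Basic)
  next
    fix A assume "A \<in> (\<inter>) unit_square ` range (\<lambda>(a, b). cbox a b)"
    then obtain a b c d where "A = unit_square \<inter> cbox (a, b) (c, d)" by auto
    then have A: "A = {max 0 a..min 1 c} \<times> {max 0 b..min 1 d}"
      by (auto simp: cbox_Pair_eq)
    show "A \<in> sigma_sets unit_square (?G ` ?I)"
    proof (cases "A = {}")
      case False
      then have "A \<in> ?G ` ?I"
        unfolding A by (intro image_eqI[where x = "(max 0 a, min 1 c, max 0 b, min 1 d)"]) auto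
      then show ?thesis by (rule sigma_sets.Basic)
    qed (simp add: sigma_sets.Empty)
  qed
qed

text \<open>
  Derivatives are taken within \<open>{0..1}\<close>, so one-sided ones at the end points. Where a partial
  derivative does not exist (a null set for a copula), \<^const>\<open>vector_derivative\<close> returns a fixed
  real number.
\<close>

definition partial1 :: "(real \<Rightarrow> real \<Rightarrow> real) \<Rightarrow> real \<Rightarrow> real \<Rightarrow> real" where
  "partial1 C x y = vector_derivative (\<lambda>s. C s y) (at x within {0..1})"

definition partial2 :: "(real \<Rightarrow> real \<Rightarrow> real) \<Rightarrow> real \<Rightarrow> real \<Rightarrow> real" where
  "partial2 C x y = vector_derivative (\<lambda>t. C x t) (at y within {0..1})"

definition sobolev_norm :: "(real \<Rightarrow> real \<Rightarrow> real) \<Rightarrow> real" where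
  "sobolev_norm C =
     sqrt (LINT y:{0..1}|lborel. LINT x:{0..1}|lborel. (partial1 C x y)\<^sup>2 + (partial2 C x y)\<^sup>2)"

definition measure_preserving_01 :: "(real \<Rightarrow> real) \<Rightarrow> bool" where
  "measure_preserving_01 T \<longleftrightarrow>
     T \<in> measurable (lebesgue_on {0..1}) (lebesgue_on {0..1}) \<and>
     (\<forall>B\<in>sets (lebesgue_on {0..1}).
        emeasure (lebesgue_on {0..1}) (T -` B \<inter> {0..1}) = emeasure (lebesgue_on {0..1}) B)"

definition S_map :: "(real \<Rightarrow> real) \<Rightarrow> real \<times> real \<Rightarrow> real \<times> real" where
  "S_map T = (\<lambda>(u, v). (T u, v))"

text \<open>
  The push-forward is taken from the completion of \<open>\<mu>\<close>: \<open>T\<close> is only Lebesgue measurable, so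
  preimages of Borel sets under \<open>S_map T\<close> need not be Borel.
\<close>

definition push_S :: "(real \<Rightarrow> real) \<Rightarrow> (real \<times> real) measure \<Rightarrow> (real \<times> real) measure" where
  "push_S T \<mu> = distr (completion \<mu>) (restrict_space borel unit_square) (S_map T)"

definition generalized_shuffle_of_Min :: "(real \<Rightarrow> real \<Rightarrow> real) \<Rightarrow> bool" where
  "generalized_shuffle_of_Min C \<longleftrightarrow>
     (\<exists>T. bij_betw T {0..1} {0..1} \<and> measure_preserving_01 T \<and>
          copula_measure C = push_S T (copula_measure min))"

end

theory Submission
  imports Defs
begin

text \<open>
  Every horizontal section of a copula is increasing and 1-Lipschitz, so it is differentiable almost
  everywhere, its derivative lies between 0 and 1, and the derivative integrates to the increment of
  the section. Hence the square of \<open>\<partial>\<^sub>1C\<close> is at most \<open>\<partial>\<^sub>1C\<close>, whose integral over the square is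
  the integral of \<open>C(1,y) = y\<close>, that is 1/2. The same holds for \<open>\<partial>\<^sub>2C\<close>. The squared norm is therefore at
  most 1, with equality exactly when both energies \<open>\<integral>\<integral>(\<partial>\<^sub>iC)\<^sup>2\<close> are 1/2
  (\<open>sobolev_norm_eq_1_iff\<close>), that is, when both partial derivatives take only the values 0 and 1 almost
  everywhere.

  The derivative \<open>\<partial>\<^sub>1C(x,y)\<close> is the conditional probability that the second coordinate is at most
  \<open>y\<close>, given that the first one is \<open>x\<close>. It takes only the values 0 and 1 exactly when the conditional law is a point
  mass, so exactly when \<open>\<mu>\<^sub>C\<close> is the law of \<open>(s, g s)\<close> under Lebesgue measure, for some \<open>g\<close>
  (\<open>energy_half_if_carried_by_graph\<close> and \<open>carried_by_graph_if_energy_half\<close>). The norm is thus 1 if and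
  only if \<open>\<mu>\<^sub>C\<close> is the law of some \<open>(s, g s)\<close> and also the law of some \<open>(h t, t)\<close>.

  If \<open>\<mu>\<^sub>C\<close> is the push-forward of \<open>\<mu>\<^sub>M\<close> by a measure-preserving bijection \<open>T\<close>, then \<open>h = T\<close> and
  \<open>g = T\<^sup>-\<^sup>1\<close> work, once the inverse is known to be measurable; inner regularity of the law of
  \<open>(T t, t)\<close> gives this (\<open>compact_approximation_of_image\<close>). Conversely, two graphs that carry the same
  law force \<open>g\<close> and \<open>h\<close> to be inverse to each other almost everywhere. So \<open>h\<close> is a bijection between
  two sets of full measure. Removing from these sets a null set with the cardinality of the continuum
  makes their complements equipotent, and \<open>h\<close> then extends to a bijection of the whole interval
  (\<open>bijective_modification\<close>).

  Almost everywhere differentiability and the fundamental theorem for nonexpansive monotone functions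
  are obtained from the Vitali covering theorem, applied to a function \<open>F\<close> and to \<open>x - F x\<close> at once.
\<close>


section \<open>Almost everywhere differentiability of nonexpansive monotone functions\<close>

text \<open>
  This class is closed under \<open>F \<mapsto> (\<lambda>x. x - F x)\<close>, which exchanges upper with lower bounds of difference
  quotients: a lower bound on the slopes of the second function is an upper bound on those of \<open>F\<close>.
\<close>

definition nonexpansive_mono :: "(real \<Rightarrow> real) \<Rightarrow> bool" where
  "nonexpansive_mono F \<longleftrightarrow> (\<forall>x y. x \<le> y \<longrightarrow> F x \<le> F y \<and> F y - F x \<le> y - x)"

text \<open>
  The intervals contain \<open>x\<close> in their interior, rather than starting at \<open>x\<close>, so that this set is a
  countable intersection of open sets.
\<close>

definition steep :: "(real \<Rightarrow> real) \<Rightarrow> real \<Rightarrow> real set" where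
  "steep F q = {x. \<forall>d>0. \<exists>a b. a < x \<and> x < b \<and> b - a < d \<and> q * (b - a) < F b - F a}"

lemma nonexpansive_mono_le: "nonexpansive_mono F \<Longrightarrow> x \<le> y \<Longrightarrow> F x \<le> F y"
  and nonexpansive_mono_diff_le: "nonexpansive_mono F \<Longrightarrow> x \<le> y \<Longrightarrow> F y - F x \<le> y - x"
  by (auto simp: nonexpansive_mono_def)

lemma nonexpansive_mono_complement: "nonexpansive_mono F \<Longrightarrow> nonexpansive_mono (\<lambda>x. x - F x)"
  unfolding nonexpansive_mono_def by (smt (verit))

lemma nonexpansive_mono_continuous: assumes "nonexpansive_mono F" shows "continuous_on UNIV F"
proof -
  have "1-lipschitz_on UNIV F"
  proof (rule lipschitz_onI)
    fix x y :: real
    show "dist (F x) (F y) \<le> 1 * dist x y"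
      using nonexpansive_mono_le[OF assms, of x y] nonexpansive_mono_le[OF assms, of y x]
        nonexpansive_mono_diff_le[OF assms, of x y] nonexpansive_mono_diff_le[OF assms, of y x]
      by (simp add: dist_real_def) linarith
  qed auto
  then show ?thesis by (rule lipschitz_on_continuous_on)
qed

lemma emeasure_interval_measure_nonexpansive_mono:
  assumes "nonexpansive_mono F" "a \<le> b"
  shows "emeasure (interval_measure F) {a..b} = ennreal (F b - F a)"
    and "emeasure (interval_measure F) {a<..<b} = ennreal (F b - F a)"
proof -
  have Icc: "emeasure (interval_measure F) {a..b} = ennreal (F b - F a)" if "a \<le> b" for a b
    using that nonexpansive_mono_le[OF assms(1)] nonexpansive_mono_continuous[OF assms(1)]
    by (rule emeasure_interval_measure_Icc)
  show "emeasure (interval_measure F) {a..b} = ennreal (F b - F a)"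
    by (rule Icc) fact
  have null: "{c} \<in> null_sets (interval_measure F)" for c
    using Icc[of c c] by (intro null_setsI) auto
  have "{a<..<b} = {a..b} - ({a} \<union> {b})" by auto
  also have "emeasure (interval_measure F) \<dots> = emeasure (interval_measure F) {a..b}"
    by (intro emeasure_Diff_null_set null_sets.Un null) simp
  finally show "emeasure (interval_measure F) {a<..<b} = ennreal (F b - F a)"
    using Icc assms by simp
qed

text \<open>
  Both sides are Borel measures, and they agree on intervals because the increments of \<open>F\<close> and of
  \<open>x - F x\<close> add up to the length of the interval.
\<close>

lemma interval_measure_complement:
  assumes "nonexpansive_mono F" "A \<in> sets borel"
  shows "emeasure (interval_measure F) A + emeasure (interval_measure (\<lambda>x. x - F x)) A
    = emeasure lborel A"
proof -
  define \<mu> where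
    "\<mu> A = emeasure (interval_measure F) A + emeasure (interval_measure (\<lambda>x. x - F x)) A" for A
  define M where "M = measure_of UNIV (sets borel) \<mu>"
  have s: "sets M = sets borel"
    unfolding M_def by (metis sets.sets_measure_of_eq space_borel)
  have e: "emeasure M A = \<mu> A" if "A \<in> sets borel" for A
  proof (rule emeasure_measure_of[OF M_def])
    show "sets borel \<subseteq> Pow UNIV" by simp
    show "A \<in> sets M" using that s by simp
    show "positive (sets M) \<mu>" by (simp add: positive_def \<mu>_def)
    show "countably_additive (sets M) \<mu>"
      unfolding countably_additive_def \<mu>_def
      by (auto simp: suminf_add[symmetric] suminf_emeasure s)
  qed
  have "lborel = M"
  proof (rule lborel_eqI)
    fix l u :: real assume lu: "\<And>b. b \<in> Basis \<Longrightarrow> l \<bullet> b \<le> u \<bullet> b"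
    then have "l \<le> u" by simp
    have "emeasure M {l<..<u} = ennreal (F u - F l) + ennreal ((u - F u) - (l - F l))"
      using \<open>l \<le> u\<close> nonexpansive_mono_complement[OF assms(1)] assms(1)
      by (simp add: e \<mu>_def emeasure_interval_measure_nonexpansive_mono)
    also have "\<dots> = ennreal (u - l)"
      using \<open>l \<le> u\<close> nonexpansive_mono_le[OF assms(1), of l u] nonexpansive_mono_diff_le[OF assms(1), of l u]
      by (subst ennreal_plus[symmetric]) auto
    finally show "emeasure M (box l u) = ennreal (\<Prod>b\<in>Basis. (u - l) \<bullet> b)"
      by (simp add: box_real)
  qed (use s in simp)
  then show ?thesis using e[OF assms(2)] by (simp add: \<mu>_def)
qed

lemma interval_measure_nonexpansive_mono_le:
  assumes "nonexpansive_mono F" "A \<in> sets borel"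
  shows "emeasure (interval_measure F) A \<le> emeasure lborel A"
  using interval_measure_complement[OF assms] by (metis le_iff_add)

text \<open>
  This is where the Vitali covering theorem is used: up to a null set, the steep intervals around
  points of \<open>E\<close> include disjoint ones that cover \<open>E\<close>, and on each of them the measure with distribution
  function \<open>F\<close> is at least \<open>q\<close> times the length.
\<close>

lemma steep_measure:
  assumes F: "nonexpansive_mono F" and q: "0 < q" and E: "E \<in> sets borel" "E \<subseteq> steep F q"
  shows "ennreal q * emeasure lborel E \<le> emeasure (interval_measure F) E"
proof (rule ennreal_le_epsilon)
  let ?\<nu> = "interval_measure F"
  fix e :: real assume "0 < e"
  \<comment> \<open>Outer regularity for Lebesgue measure also controls \<open>?\<nu>\<close>, which it dominates.\<close>
  obtain U where U: "open U" "E \<subseteq> U" "U - E \<in> lmeasurable" "emeasure lebesgue (U - E) < ennreal e"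
    using sets_lebesgue_outer_open[of E e] E \<open>0 < e\<close> by auto
  have U_borel: "U \<in> sets borel" using U by auto
  define K where "K = {(a, b). a < b \<and> {a..b} \<subseteq> U \<and> q * (b - a) < F b - F a}"
  \<comment> \<open>The covering theorem speaks of balls, given by centre and radius.\<close>
  have cb: "cball ((fst i + snd i) / 2) ((snd i - fst i) / 2) = {fst i..snd i}" for i :: "real \<times> real"
    by (auto simp: cball_eq_atLeastAtMost field_simps)
  obtain C where C: "countable C" "C \<subseteq> K"
    "pairwise (\<lambda>i j. disjnt (cball ((fst i + snd i) / 2) ((snd i - fst i) / 2))
       (cball ((fst j + snd j) / 2) ((snd j - fst j) / 2))) C"
    "negligible (E - (\<Union>i\<in>C. cball ((fst i + snd i) / 2) ((snd i - fst i) / 2)))"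
  proof (rule Vitali_covering_theorem_cballs[of K "\<lambda>i. (snd i - fst i) / 2" E "\<lambda>i. (fst i + snd i) / 2"])
    show "0 < (snd i - fst i) / 2" if "i \<in> K" for i using that by (auto simp: K_def)
    fix x d :: real assume "x \<in> E" "0 < d"
    then obtain r where r: "0 < r" "cball x r \<subseteq> U"
      using U open_contains_cball by blast
    have "0 < min r d" using r \<open>0 < d\<close> by simp
    then obtain a b where ab: "a < x" "x < b" "b - a < min r d" "q * (b - a) < F b - F a"
      using E(2) \<open>x \<in> E\<close> unfolding steep_def by blast
    have "{a..b} \<subseteq> cball x r" using ab by (auto simp: cball_eq_atLeastAtMost)
    then show "\<exists>i. i \<in> K \<and> x \<in> cball ((fst i + snd i) / 2) ((snd i - fst i) / 2) \<and> (snd i - fst i) / 2 < d"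
      unfolding cb using ab r by (intro exI[of _ "(a, b)"]) (auto simp: K_def)
  qed (use that in blast)
  define I where "I i = {fst i..snd i}" for i :: "real \<times> real"
  have VU: "(\<Union>i\<in>C. I i) \<subseteq> U"
  proof (rule UN_least)
    fix i assume "i \<in> C"
    then have "i \<in> K" using C(2) by blast
    then show "I i \<subseteq> U" by (simp add: K_def I_def case_prod_beta)
  qed
  have disj: "disjoint_family_on I C"
    using C(3) unfolding cb I_def disjoint_family_on_def pairwise_def disjnt_def by blast
  let ?V = "\<Union>i\<in>C. I i"
  have V: "?V \<in> sets borel" by (intro sets.countable_UN'' C(1)) (auto simp: I_def)
  have "E - ?V \<in> null_sets lborel"
    using C(4) E V unfolding cb I_def[symmetric]
    by (simp add: negligible_iff_null_sets null_sets_completion_iff)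
  have "emeasure lborel E \<le> emeasure lborel (?V \<union> (E - ?V))"
    using E V by (intro emeasure_mono) auto
  also have "\<dots> = emeasure lborel ?V"
    using \<open>E - ?V \<in> null_sets lborel\<close> V by (intro emeasure_Un_null_set) auto
  finally have "ennreal q * emeasure lborel E \<le> ennreal q * emeasure lborel ?V"
    by (rule mult_left_mono) simp
  also have "\<dots> = (\<integral>\<^sup>+i. ennreal q * emeasure lborel (I i) \<partial>count_space C)"
    by (subst emeasure_UN_countable[OF _ C(1) disj]) (auto simp: I_def nn_integral_cmult)
  also have "\<dots> \<le> (\<integral>\<^sup>+i. emeasure ?\<nu> (I i) \<partial>count_space C)"
  proof (rule nn_integral_mono)
    fix i assume "i \<in> space (count_space C)"
    then have "fst i < snd i" "q * (snd i - fst i) \<le> F (snd i) - F (fst i)"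
      using C(2) by (auto simp: K_def)
    then show "ennreal q * emeasure lborel (I i) \<le> emeasure ?\<nu> (I i)"
      using q by (simp add: I_def emeasure_interval_measure_nonexpansive_mono(1)[OF F] ennreal_leI flip: ennreal_mult)
  qed
  also have "\<dots> = emeasure ?\<nu> ?V"
    by (subst emeasure_UN_countable[OF _ C(1) disj]) (auto simp: I_def)
  also have "\<dots> \<le> emeasure ?\<nu> (E \<union> (U - E))"
    using VU U_borel E(1) by (intro emeasure_mono) auto
  also have "\<dots> \<le> emeasure ?\<nu> E + emeasure ?\<nu> (U - E)"
    using U_borel E(1) by (intro emeasure_subadditive) auto
  also have "emeasure ?\<nu> (U - E) \<le> emeasure lborel (U - E)"
    using U_borel E(1) by (intro interval_measure_nonexpansive_mono_le[OF F]) auto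
  also have "\<dots> \<le> ennreal e"
    using U(4) U_borel E(1) by simp
  finally show "ennreal q * emeasure lborel E \<le> emeasure ?\<nu> E + ennreal e"
    by (simp add: add_left_mono)
qed

text \<open>
  The dependence on a parameter is kept so that the partial derivative of a copula is seen to be
  jointly measurable in both variables.
\<close>

lemma steep_family_borel:
  fixes H :: "real \<Rightarrow> real \<Rightarrow> real"
  assumes H: "\<And>s. continuous_on UNIV (H s)"
  shows "{z. fst z \<in> steep (\<lambda>s. H s (snd z)) q} \<in> sets borel"
proof -
  define W where "W n = (\<Union>(a, b)\<in>{(a, b). b - a < inverse (real (Suc n))}.
    {z. a < fst z \<and> fst z < b \<and> q * (b - a) < H b (snd z) - H a (snd z)})" for n
  have "{z. fst z \<in> steep (\<lambda>s. H s (snd z)) q} = (\<Inter>n. W n)"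
  proof (intro equalityI subsetI INT_I)
    fix z n assume "z \<in> {z. fst z \<in> steep (\<lambda>s. H s (snd z)) q}"
    moreover have "0 < inverse (real (Suc n))" by simp
    ultimately obtain a b where "a < fst z" "fst z < b" "b - a < inverse (real (Suc n))"
        "q * (b - a) < H b (snd z) - H a (snd z)"
      unfolding steep_def by blast
    then show "z \<in> W n" unfolding W_def by auto
  next
    fix z assume z: "z \<in> (\<Inter>n. W n)"
    show "z \<in> {z. fst z \<in> steep (\<lambda>s. H s (snd z)) q}" unfolding steep_def mem_Collect_eq
    proof (intro allI impI)
      fix d :: real assume "0 < d"
      then obtain n where n: "inverse (real (Suc n)) < d" using reals_Archimedean by blast
      have "z \<in> W n" using z by blast
      then obtain a b where "a < fst z" "fst z < b" "b - a < inverse (real (Suc n))"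
          "q * (b - a) < H b (snd z) - H a (snd z)"
        unfolding W_def by auto
      then show "\<exists>a b. a < fst z \<and> fst z < b \<and> b - a < d \<and> q * (b - a) < H b (snd z) - H a (snd z)"
        using n by (meson less_trans)
    qed
  qed
  moreover have "open (W n)" for n
    unfolding W_def
    by (auto intro!: open_UN open_Collect_conj open_Collect_less continuous_intros
        continuous_on_compose2[OF H])
  ultimately show ?thesis by auto
qed

lemma steep_borel: "steep F q \<in> sets borel"
proof -
  have "{z::real \<times> real. fst z \<in> steep F q} \<in> sets borel"
    using steep_family_borel[of "\<lambda>s y. F s" q] by simp
  then have "(\<lambda>x. (x, 0::real)) -` {z. fst z \<in> steep F q} \<inter> space borel \<in> sets borel"
    by (rule measurable_sets[rotated]) auto
  then show ?thesis by (simp add: vimage_def)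
qed

text \<open>
  On a bounded part \<open>E\<close> of this set, \<open>F\<close> gives at least \<open>q\<close> times, and \<open>x - F x\<close> at least \<open>1 - p\<close> times the
  length of \<open>E\<close>. The two measures sum to Lebesgue measure, although \<open>q + (1 - p) > 1\<close>; so \<open>E\<close> is null.
\<close>

lemma steep_null:
  assumes F: "nonexpansive_mono F" and "0 < p" "p < q" "q < 1"
  shows "steep F q \<inter> steep (\<lambda>x. x - F x) (1 - p) \<in> null_sets lborel"
proof -
  let ?S = "steep F q \<inter> steep (\<lambda>x. x - F x) (1 - p)"
  have "?S \<inter> {-real n..real n} \<in> null_sets lborel" for n
  proof -
    let ?E = "?S \<inter> {-real n..real n}"
    have E: "?E \<in> sets borel" by (intro sets.Int steep_borel) auto
    have "emeasure lborel ?E \<le> emeasure lborel {-real n..real n}"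
      by (intro emeasure_mono) auto
    then have fin: "emeasure lborel ?E < \<infinity>" by (auto simp: less_top intro: le_less_trans)
    have "ennreal q * emeasure lborel ?E + ennreal (1 - p) * emeasure lborel ?E \<le>
        emeasure (interval_measure F) ?E + emeasure (interval_measure (\<lambda>x. x - F x)) ?E"
      using assms E by (intro add_mono steep_measure nonexpansive_mono_complement) auto
    also have "\<dots> = emeasure lborel ?E"
      by (rule interval_measure_complement[OF F E])
    finally have "ennreal (q + (1 - p)) * emeasure lborel ?E \<le> emeasure lborel ?E"
      using assms by (simp add: distrib_right)
    moreover obtain r where r: "0 \<le> r" "emeasure lborel ?E = ennreal r"
      using fin by (cases "emeasure lborel ?E") auto
    ultimately have "ennreal ((q + (1 - p)) * r) \<le> ennreal r"
      using assms by (simp add: ennreal_mult)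
    then have "(q + (1 - p)) * r \<le> r"
      using r by (simp add: ennreal_le_iff)
    then have "(q - p) * r \<le> 0" by (simp add: algebra_simps)
    then have "r = 0" using assms r by (simp add: mult_le_0_iff)
    then show ?thesis using r E by (intro null_setsI) auto
  qed
  then have "(\<Union>n. ?S \<inter> {-real n..real n}) \<in> null_sets lborel"
    by (rule null_sets_UN)
  also have "(\<Union>n. ?S \<inter> {-real n..real n}) = ?S"
  proof -
    have "\<exists>n. x \<in> {-real n..real n}" for x :: real
      using real_arch_simple[of "\<bar>x\<bar>"] by (auto simp: abs_le_iff minus_le_iff)
    then show ?thesis by blast
  qed
  finally show ?thesis .
qed


text \<open>
  A one-sided interval from \<open>x\<close> to \<open>x + h\<close> with a large quotient can be enlarged slightly beyond \<open>x\<close>: the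
  increment of \<open>F\<close> does not decrease, and the length hardly grows.
\<close>

lemma steep_if_frequently_slope:
  assumes F: "nonexpansive_mono F" and fr: "frequently (\<lambda>h. q < (F (x + h) - F x) / h) (at 0)" and q: "0 < q"
  shows "x \<in> steep F q"
  unfolding steep_def
proof safe
  fix d :: real assume "0 < d"
  have "eventually (\<lambda>h::real. h \<noteq> 0 \<and> \<bar>h\<bar> < d / 2) (at 0)"
    using \<open>0 < d\<close> unfolding eventually_at by (intro exI[of _ "d / 2"]) auto
  with fr have "frequently (\<lambda>h. q < (F (x + h) - F x) / h \<and> h \<noteq> 0 \<and> \<bar>h\<bar> < d / 2) (at 0)"
    by (auto elim: frequently_rev_mp eventually_mono)
  then obtain h where h: "q < (F (x + h) - F x) / h" "h \<noteq> 0" "\<bar>h\<bar> < d / 2"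
    using frequently_ex by blast
  let ?D = "\<bar>F (x + h) - F x\<bar> - q * \<bar>h\<bar>"
  have D: "0 < ?D"
    using h(1,2) q nonexpansive_mono_le[OF F, of x "x + h"] nonexpansive_mono_le[OF F, of "x + h" x]
    by (cases "0 < h") (auto simp: field_simps)
  \<comment> \<open>An enlargement by at most \<open>?D / (2 * q)\<close> costs at most half of the surplus \<open>?D\<close>.\<close>
  define \<eta> where "\<eta> = min (d / 2) (?D / (2 * q))"
  have \<eta>: "0 < \<eta>" "\<eta> \<le> d / 2" "q * \<eta> < ?D"
  proof -
    show "0 < \<eta>" "\<eta> \<le> d / 2" using \<open>0 < d\<close> D q by (auto simp: \<eta>_def)
    have "q * \<eta> \<le> q * (?D / (2 * q))" using q by (intro mult_left_mono) (auto simp: \<eta>_def)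
    also have "\<dots> = ?D / 2" using q by simp
    also have "\<dots> < ?D" using D by simp
    finally show "q * \<eta> < ?D" .
  qed
  show "\<exists>a b. a < x \<and> x < b \<and> b - a < d \<and> q * (b - a) < F b - F a"
  proof (cases "0 < h")
    case True
    have "F (x - \<eta>) \<le> F x" "F x \<le> F (x + h)" using F \<eta> True by (auto intro: nonexpansive_mono_le)
    then show ?thesis using \<eta> h True
      by (intro exI[of _ "x - \<eta>"] exI[of _ "x + h"]) (auto simp: algebra_simps)
  next
    case False
    have "F x \<le> F (x + \<eta>)" "F (x + h) \<le> F x" using F \<eta> False by (auto intro: nonexpansive_mono_le)
    then show ?thesis using \<eta> h False
      by (intro exI[of _ "x + h"] exI[of _ "x + \<eta>"]) (auto simp: algebra_simps)
  qed
qed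

text \<open>
  The straddle lemma: at a point of differentiability, quotients over intervals that contain the point
  also tend to the derivative.
\<close>

lemma derivative_ge_if_steep:
  assumes D: "(F has_vector_derivative D) (at x)" and x: "x \<in> steep F q"
  shows "q \<le> D"
proof (rule ccontr)
  assume "\<not> q \<le> D"
  then have "0 < q - D" by simp
  then obtain d where d: "0 < d"
    "\<And>y. \<bar>y - x\<bar> < d \<Longrightarrow> \<bar>F y - F x - (y - x) * D\<bar> \<le> (q - D) * \<bar>y - x\<bar>"
    using D unfolding has_vector_derivative_def has_derivative_at_alt real_norm_def real_scaleR_def
    by blast
  obtain a b where ab: "a < x" "x < b" "b - a < d" "q * (b - a) < F b - F a"
    using x \<open>0 < d\<close> unfolding steep_def by blast
  have "F b - F x - (b - x) * D \<le> (q - D) * (b - x)" "- (F a - F x - (a - x) * D) \<le> (q - D) * (x - a)"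
    using d(2)[of b] d(2)[of a] ab by auto
  then have "F b - F a \<le> q * (b - a)" by (simp add: algebra_simps)
  then show False using ab by simp
qed

lemma nonexpansive_mono_slope_bounds:
  assumes "nonexpansive_mono F" "h \<noteq> 0"
  shows "0 \<le> (F (x + h) - F x) / h" "(F (x + h) - F x) / h \<le> 1"
  using assms(2) nonexpansive_mono_le[OF assms(1), of x "x + h"] nonexpansive_mono_le[OF assms(1), of "x + h" x]
    nonexpansive_mono_diff_le[OF assms(1), of x "x + h"] nonexpansive_mono_diff_le[OF assms(1), of "x + h" x]
  by (cases "0 < h"; simp add: divide_simps)+

text \<open>
  Difference quotients are bounded, so the derivative fails to exist only if two rationals \<open>p < q\<close> can be
  put strictly between their lower and upper limit. This describes the exceptional set by countably
  many steep sets, which makes it both null and Borel.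
\<close>

lemma nonexpansive_mono_differentiable_iff:
  assumes F: "nonexpansive_mono F"
  shows "(\<exists>D. (F has_vector_derivative D) (at x)) \<longleftrightarrow>
    \<not> (\<exists>p q :: rat. 0 < p \<and> p < q \<and> q < 1 \<and>
       x \<in> steep F (real_of_rat q) \<and> x \<in> steep (\<lambda>x. x - F x) (1 - real_of_rat p))"
    (is "?L \<longleftrightarrow> \<not> ?R")
proof
  assume ?L
  then obtain D where D: "(F has_vector_derivative D) (at x)" by blast
  show "\<not> ?R"
  proof
    assume ?R
    then obtain p q where pq: "p < q" "x \<in> steep F (real_of_rat q)"
      "x \<in> steep (\<lambda>x. x - F x) (1 - real_of_rat p)" by blast
    have "((\<lambda>x. x - F x) has_vector_derivative 1 - D) (at x)"
      using D by (auto intro!: derivative_eq_intros)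
    then have "real_of_rat q \<le> real_of_rat p"
      using derivative_ge_if_steep[OF D pq(2)] derivative_ge_if_steep[OF _ pq(3)] by fastforce
    then show False using pq(1) by (simp add: of_rat_less_eq)
  qed
next
  assume nR: "\<not> ?R"
  let ?s = "\<lambda>h. (F (x + h) - F x) / h"
  define L where "L = Liminf (at 0) (\<lambda>h. ereal (?s h))"
  define M where "M = Limsup (at 0) (\<lambda>h. ereal (?s h))"
  have "L \<le> M" unfolding L_def M_def by (intro Liminf_le_Limsup) simp
  have nz: "eventually (\<lambda>h::real. h \<noteq> 0) (at 0)" by (simp add: eventually_at_filter)
  have "0 \<le> L" unfolding L_def
    by (intro Liminf_bounded eventually_mono[OF nz]) (auto simp: nonexpansive_mono_slope_bounds[OF F])
  have "M \<le> 1" unfolding M_def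
    by (intro Limsup_bounded eventually_mono[OF nz]) (auto simp: nonexpansive_mono_slope_bounds[OF F] one_ereal_def)
  have "\<not> L < M"
  proof
    assume "L < M"
    then obtain p where p: "L < real_of_rat p" "real_of_rat p < M" using ereal_dense3 by blast
    then obtain q where q: "real_of_rat p < ereal (real_of_rat q)" "ereal (real_of_rat q) < M"
      using ereal_dense3 by blast
    have "0 < ereal (real_of_rat p)" using \<open>0 \<le> L\<close> p(1) by (rule le_less_trans)
    then have p0: "0 < p" by simp
    have "ereal (real_of_rat q) < 1" using q(2) \<open>M \<le> 1\<close> by (rule less_le_trans)
    then have q1: "q < 1" by (simp add: one_ereal_def)
    have pq: "p < q" using q(1) by (simp add: of_rat_less)
    have "frequently (\<lambda>h. real_of_rat q < ?s h) (at 0)"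
    proof (rule ccontr)
      assume "\<not> ?thesis"
      then have "eventually (\<lambda>h. ereal (?s h) \<le> ereal (real_of_rat q)) (at 0)"
        by (simp add: not_frequently not_less)
      then have "M \<le> ereal (real_of_rat q)" unfolding M_def by (rule Limsup_bounded)
      then show False using q(2) by simp
    qed
    then have x1: "x \<in> steep F (real_of_rat q)"
      by (intro steep_if_frequently_slope[OF F]) (use p0 pq in auto)
    have "frequently (\<lambda>h. ?s h < real_of_rat p) (at 0)"
    proof (rule ccontr)
      assume "\<not> ?thesis"
      then have "eventually (\<lambda>h. ereal (real_of_rat p) \<le> ereal (?s h)) (at 0)"
        by (simp add: not_frequently not_less)
      then have "ereal (real_of_rat p) \<le> L" unfolding L_def by (rule Liminf_bounded)
      then show False using p(1) by simp
    qed
    then have "frequently (\<lambda>h. 1 - real_of_rat p < ((x + h - F (x + h)) - (x - F x)) / h) (at 0)"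
    proof (rule frequently_rev_mp, intro eventually_mono[OF nz] impI)
      fix h :: real assume "h \<noteq> 0" "?s h < real_of_rat p"
      then show "1 - real_of_rat p < ((x + h - F (x + h)) - (x - F x)) / h"
        by (simp add: diff_divide_distrib add_divide_distrib)
    qed
    then have "x \<in> steep (\<lambda>x. x - F x) (1 - real_of_rat p)"
      by (intro steep_if_frequently_slope[OF nonexpansive_mono_complement[OF F]]) (use pq q1 in \<open>auto simp: of_rat_less_1_iff\<close>)
    then show False using nR x1 p0 pq q1 by blast
  qed
  then have "L = M" using \<open>L \<le> M\<close> by simp
  obtain D where D: "L = ereal D"
    using \<open>0 \<le> L\<close> \<open>M \<le> 1\<close> \<open>L = M\<close> by (cases L) auto
  have "((\<lambda>h. ereal (?s h)) \<longlongrightarrow> L) (at 0)"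
    using \<open>L = M\<close> unfolding L_def M_def by (intro Liminf_eq_Limsup) auto
  then have "(?s \<longlongrightarrow> D) (at 0)" unfolding D by simp
  then have "(F has_field_derivative D) (at x)" by (simp add: DERIV_def)
  then show ?L by (auto simp: has_real_derivative_iff_has_vector_derivative)
qed

lemma nonexpansive_mono_differentiable_AE:
  assumes F: "nonexpansive_mono F"
  shows "AE x in lborel. \<exists>D. (F has_vector_derivative D) (at x)"
proof -
  let ?N = "\<lambda>(p::rat, q::rat). steep F (real_of_rat q) \<inter> steep (\<lambda>x. x - F x) (1 - real_of_rat p)"
  have "(\<Union>i\<in>{(p, q). 0 < p \<and> p < q \<and> q < 1}. ?N i) \<in> null_sets lborel"
    by (intro null_sets_UN') (auto intro!: steep_null[OF F] simp: of_rat_less)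
  then show ?thesis
    by (rule AE_I') (auto simp: nonexpansive_mono_differentiable_iff[OF F])
qed

section \<open>Borel measurability and integration of the derivative\<close>

text \<open>
  Bochner integrals with respect to \<^const>\<open>lborel\<close> are sensitive to measurability on null sets, so the
  value of the derivative at points of non-differentiability has to be known: it is one fixed number.
\<close>

lemma vector_derivative_undefined:
  fixes F :: "real \<Rightarrow> real"
  assumes "\<not> (\<exists>D. (F has_vector_derivative D) (at x))"
  shows "vector_derivative F (at x) = (SOME D. False)"
  using assms by (simp add: vector_derivative_def)

lemma nonexpansive_mono_derivative_bounds:
  assumes F: "nonexpansive_mono F" and D: "(F has_vector_derivative D) (at x)"
  shows "0 \<le> D" "D \<le> 1"
proof -
  have lim: "((\<lambda>h. (F (x + h) - F x) / h) \<longlongrightarrow> D) (at 0)"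
    using D by (simp add: DERIV_def flip: has_real_derivative_iff_has_vector_derivative)
  have nz: "eventually (\<lambda>h::real. h \<noteq> 0) (at 0)" by (simp add: eventually_at_filter)
  show "0 \<le> D"
    by (rule tendsto_lowerbound[OF lim]) (auto intro!: eventually_mono[OF nz] nonexpansive_mono_slope_bounds[OF F])
  show "D \<le> 1"
    by (rule tendsto_upperbound[OF lim]) (auto intro!: eventually_mono[OF nz] nonexpansive_mono_slope_bounds[OF F])
qed

lemma has_vector_derivative_imp_difference_quotients:
  fixes F :: "real \<Rightarrow> real"
  assumes "(F has_vector_derivative D) (at x)"
  shows "(\<lambda>n. (F (x + inverse (real (Suc n))) - F x) / inverse (real (Suc n))) \<longlonglongrightarrow> D"
proof -
  have "((\<lambda>h. (F (x + h) - F x) / h) \<longlongrightarrow> D) (at 0)"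
    using assms by (simp add: DERIV_def flip: has_real_derivative_iff_has_vector_derivative)
  moreover have "filterlim (\<lambda>n. inverse (real (Suc n))) (at 0) sequentially"
    unfolding filterlim_at using LIMSEQ_inverse_real_of_nat by auto
  ultimately show ?thesis by (rule filterlim_compose)
qed

lemma borel_measurable_vector_derivative_family:
  fixes G :: "real \<Rightarrow> real \<Rightarrow> real"
  assumes G: "continuous_on UNIV (\<lambda>z. G (fst z) (snd z))" and G_slice: "\<And>y. nonexpansive_mono (\<lambda>s. G s y)"
  shows "(\<lambda>z. vector_derivative (\<lambda>s. G s (snd z)) (at (fst z))) \<in> borel_measurable borel"
proof -
  have Gs: "continuous_on UNIV (G s)" for s
  proof -
    have "continuous_on UNIV (\<lambda>y. G (fst (s, y)) (snd (s, y)))"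
      by (rule continuous_on_compose2[OF G]) (auto intro!: continuous_intros)
    then show ?thesis by simp
  qed
  define N where "N = (\<Union>(p, q)\<in>{(p::rat, q::rat). 0 < p \<and> p < q \<and> q < 1}.
    {z. fst z \<in> steep (\<lambda>s. G s (snd z)) (real_of_rat q)} \<inter>
    {z. fst z \<in> steep (\<lambda>s. s - G s (snd z)) (1 - real_of_rat p)})"
  have N: "N \<in> sets borel" unfolding N_def
    by (auto intro!: sets.countable_UN' sets.Int steep_family_borel continuous_intros Gs)
  have N_iff: "z \<in> N \<longleftrightarrow> \<not> (\<exists>D. ((\<lambda>s. G s (snd z)) has_vector_derivative D) (at (fst z)))" for z
    unfolding nonexpansive_mono_differentiable_iff[OF G_slice] N_def by auto
  have meas: "(\<lambda>z. G (fst z + c) (snd z)) \<in> borel_measurable borel" for c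
    by (intro borel_measurable_continuous_onI continuous_on_compose2[OF G, of UNIV "\<lambda>z. (fst z + c, snd z)", simplified])
      (auto intro!: continuous_intros)
  let ?f = "\<lambda>z. if z \<in> N then (SOME D. False) else
    lim (\<lambda>n. (G (fst z + inverse (real (Suc n))) (snd z) - G (fst z) (snd z)) / inverse (real (Suc n)))"
  have "?f \<in> borel_measurable borel"
    using N meas meas[of 0] by (intro measurable_If_set borel_measurable_lim_metric
        borel_measurable_divide borel_measurable_diff) auto
  moreover have "?f z = vector_derivative (\<lambda>s. G s (snd z)) (at (fst z))" for z
  proof (cases "z \<in> N")
    case True
    then show ?thesis using vector_derivative_undefined[of "\<lambda>s. G s (snd z)" "fst z"] N_iff[of z] by simp
  next
    case False
    then obtain D where D: "((\<lambda>s. G s (snd z)) has_vector_derivative D) (at (fst z))"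
      using N_iff by blast
    then show ?thesis
      using has_vector_derivative_imp_difference_quotients[OF D] False
      by (simp add: vector_derivative_at[OF D] limI)
  qed
  ultimately show ?thesis by simp
qed

lemma borel_measurable_vector_derivative_nonexpansive_mono:
  assumes "nonexpansive_mono F" shows "(\<lambda>x. vector_derivative F (at x)) \<in> borel_measurable borel"
proof -
  have "continuous_on UNIV (\<lambda>z::real \<times> real. F (fst z))"
    by (rule continuous_on_compose2[OF nonexpansive_mono_continuous[OF assms]]) (auto intro!: continuous_intros)
  then have "(\<lambda>z::real \<times> real. vector_derivative F (at (fst z))) \<in> borel_measurable borel"
    using borel_measurable_vector_derivative_family[of "\<lambda>s y. F s"] assms by simp
  then have "(\<lambda>z::real \<times> real. vector_derivative F (at (fst z))) \<circ> (\<lambda>x. (x, 0)) \<in> borel_measurable borel"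
    by (intro measurable_comp[of _ borel borel]) auto
  then show ?thesis by (simp add: comp_def)
qed

lemma abs_vector_derivative_nonexpansive_mono_le:
  assumes "nonexpansive_mono F"
  shows "\<bar>vector_derivative F (at x)\<bar> \<le> max 1 \<bar>SOME D::real. False\<bar>"
proof (cases "\<exists>D. (F has_vector_derivative D) (at x)")
  case True
  then obtain D where D: "(F has_vector_derivative D) (at x)" by blast
  show ?thesis using nonexpansive_mono_derivative_bounds[OF assms D] by (simp add: vector_derivative_at[OF D])
qed (simp add: vector_derivative_undefined)

text \<open>
  The difference quotients are bounded by 1 and converge almost everywhere, so dominated convergence
  applies. The integral of \<open>(F (x + h) - F x) / h\<close> is computed with a primitive \<open>\<Phi>\<close> of \<open>F\<close>: it is
  the difference between \<open>b\<close> and \<open>a\<close> of the difference quotients of \<open>\<Phi>\<close>, which tend to \<open>F b\<close> and \<open>F a\<close>.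
\<close>

lemma nonexpansive_mono_FTC:
  assumes F: "nonexpansive_mono F" and ab: "a \<le> b"
  shows "(LINT x:{a..b}|lborel. vector_derivative F (at x)) = F b - F a"
proof -
  define h where "h n = inverse (real (Suc n))" for n
  have h: "0 < h n" "h n \<le> 1" for n by (auto simp: h_def field_simps)
  \<comment> \<open>The interval leaves room for the shifts \<open>h n \<le> 1\<close> and makes all points involved interior.\<close>
  obtain \<Phi> where \<Phi>': "\<And>x. x \<in> {a-1..b+2} \<Longrightarrow> (\<Phi> has_vector_derivative F x) (at x within {a-1..b+2})"
    using antiderivative_continuous[of "a-1" "b+2" F] nonexpansive_mono_continuous[OF F] continuous_on_subset by blast
  have \<Phi>: "(\<Phi> has_real_derivative F x) (at x)" if "a - 1 < x" "x < b + 2" for x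
    using \<Phi>'[of x] that at_within_Icc_at[of "a-1" x "b+2"]
    by (simp add: has_real_derivative_iff_has_vector_derivative)
  let ?q = "\<lambda>n x. (F (x + h n) - F x) / h n"
  have cont: "continuous_on A (\<lambda>x. F (x + c))" for A c
    by (intro continuous_on_compose2[OF nonexpansive_mono_continuous[OF F]] continuous_intros) auto
  have meas: "?q n \<in> borel_measurable borel" for n
    using cont[of UNIV 0] cont[of UNIV "h n"]
    by (intro borel_measurable_continuous_onI continuous_intros) (use h in \<open>auto simp: less_imp_neq[symmetric]\<close>)
  have eq: "(LINT x:{a..b}|lborel. ?q n x) = ((\<Phi> (b + h n) - \<Phi> b) / h n) - ((\<Phi> (a + h n) - \<Phi> a) / h n)" for n
  proof -
    have "integral\<^sup>L lborel (\<lambda>x. indicator {a..b} x *\<^sub>R ?q n x) =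
        (\<Phi> (b + h n) - \<Phi> b) / h n - (\<Phi> (a + h n) - \<Phi> a) / h n"
    proof (rule integral_FTC_atLeastAtMost[OF ab])
      fix x assume x: "a \<le> x" "x \<le> b"
      have "((\<lambda>x. \<Phi> (x + h n)) has_real_derivative F (x + h n)) (at x)"
        using \<Phi>[of "x + h n"] x h[of n] by (simp add: DERIV_shift)
      moreover have "(\<Phi> has_real_derivative F x) (at x)"
        using \<Phi>[of "x"] x h[of n] by simp
      ultimately have "((\<lambda>x. (\<Phi> (x + h n) - \<Phi> x) / h n) has_real_derivative ?q n x) (at x)"
        using h[of n] by (auto intro!: derivative_eq_intros)
      then show "((\<lambda>x. (\<Phi> (x + h n) - \<Phi> x) / h n) has_vector_derivative ?q n x) (at x within {a..b})"
        by (simp add: has_real_derivative_iff_has_vector_derivative has_vector_derivative_at_within)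
    next
      show "continuous_on {a..b} (?q n)"
        using cont[of _ 0] cont[of _ "h n"] h[of n] by (intro continuous_intros) auto
    qed
    then show ?thesis by (simp add: set_lebesgue_integral_def)
  qed
  have "(\<lambda>n. LINT x:{a..b}|lborel. ?q n x) \<longlonglongrightarrow> (LINT x:{a..b}|lborel. vector_derivative F (at x))"
    unfolding set_lebesgue_integral_def
  proof (rule integral_dominated_convergence[where w = "indicator {a..b}"])
    show "(\<lambda>x. indicator {a..b} x *\<^sub>R vector_derivative F (at x)) \<in> borel_measurable lborel"
      using borel_measurable_vector_derivative_nonexpansive_mono[OF F] by simp
    show "(\<lambda>x. indicator {a..b} x *\<^sub>R ?q n x) \<in> borel_measurable lborel" for n
      using meas[of n] by (intro borel_measurable_scaleR) auto
    show "integrable lborel (indicator {a..b} :: real \<Rightarrow> real)"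
      using ab by (intro integrable_real_indicator) auto
    show "AE x in lborel. norm (indicator {a..b} x *\<^sub>R ?q n x) \<le> indicator {a..b} x" for n
    proof (rule AE_I2)
      fix x
      have "\<bar>?q n x\<bar> \<le> 1"
        using nonexpansive_mono_slope_bounds[OF F, of "h n" x] h[of n] by (intro abs_leI) auto
      then show "norm (indicator {a..b} x *\<^sub>R ?q n x) \<le> indicator {a..b} x"
        by (cases "x \<in> {a..b}") (simp_all del: abs_divide)
    qed
    show "AE x in lborel. (\<lambda>n. indicator {a..b} x *\<^sub>R ?q n x) \<longlonglongrightarrow>
        indicator {a..b} x *\<^sub>R vector_derivative F (at x)"
      using nonexpansive_mono_differentiable_AE[OF F]
    proof eventually_elim
      case (elim x)
      then obtain D where D: "(F has_vector_derivative D) (at x)" by blast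
      show ?case
        using has_vector_derivative_imp_difference_quotients[OF D]
        unfolding vector_derivative_at[OF D] h_def by (intro tendsto_intros)
    qed
  qed
  moreover have "(\<lambda>n. LINT x:{a..b}|lborel. ?q n x) \<longlonglongrightarrow> F b - F a"
    unfolding eq using \<Phi>[of a] \<Phi>[of b] ab unfolding h_def
    by (intro tendsto_diff has_vector_derivative_imp_difference_quotients)
      (auto simp flip: has_real_derivative_iff_has_vector_derivative)
  ultimately show ?thesis by (rule LIMSEQ_unique)
qed


section \<open>Copulas and the energy of a partial derivative\<close>

abbreviation unif :: "real measure" where
  "unif \<equiv> restrict_space lborel {0..1}"

definition clamp01 :: "real \<Rightarrow> real" where
  "clamp01 x = max 0 (min 1 x)"

lemma clamp01_range: "clamp01 x \<in> {0..1}" and clamp01_id: "x \<in> {0..1} \<Longrightarrow> clamp01 x = x"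
  by (auto simp: clamp01_def)

lemma nonexpansive_mono_clamp01: "nonexpansive_mono clamp01"
  by (auto simp: nonexpansive_mono_def clamp01_def)

abbreviation (input) transposed :: "(real \<Rightarrow> real \<Rightarrow> real) \<Rightarrow> real \<Rightarrow> real \<Rightarrow> real" where
  "transposed C \<equiv> \<lambda>x y. C y x"

text \<open>
  The first partial derivative of the extension of \<open>C\<close> to the plane that is constant outside the unit
  square along each axis. The extension is nonexpansive and monotone in each variable on the whole
  line, and its derivative agrees with \<^const>\<open>partial1\<close> on the unit square except on the vertical sides.
\<close>

definition deriv1 :: "(real \<Rightarrow> real \<Rightarrow> real) \<Rightarrow> real \<Rightarrow> real \<Rightarrow> real" where
  "deriv1 C x y = vector_derivative (\<lambda>s. C (clamp01 s) (clamp01 y)) (at x)"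

definition energy :: "(real \<Rightarrow> real \<Rightarrow> real) \<Rightarrow> real" where
  "energy C = (\<integral>y. (\<integral>x. (deriv1 C x y)\<^sup>2 \<partial>unif) \<partial>unif)"

text \<open>
  The right-hand side is the distribution function of \<open>(s, g s)\<close> for \<open>s\<close> uniform on the unit interval.
\<close>

definition carried_by_graph :: "(real \<Rightarrow> real \<Rightarrow> real) \<Rightarrow> (real \<Rightarrow> real) \<Rightarrow> bool" where
  "carried_by_graph C g \<longleftrightarrow> g \<in> unif \<rightarrow>\<^sub>M unif \<and>
     (\<forall>x\<in>{0..1}. \<forall>y\<in>{0..1}. C x y = measure unif {s\<in>{0..1}. s \<le> x \<and> g s \<le> y})"

lemma emeasure_unif: "A \<subseteq> {0..1} \<Longrightarrow> emeasure unif A = emeasure lborel A"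
  by (intro emeasure_restrict_space) auto

lemma sets_unif: "A \<in> sets unif \<longleftrightarrow> A \<subseteq> {0..1} \<and> A \<in> sets borel"
  by (subst sets_restrict_space_iff) auto

lemma finite_measure_unif: "finite_measure unif"
  by (intro finite_measureI) (simp add: emeasure_unif)

interpretation unif: finite_measure unif by (rule finite_measure_unif)

interpretation unif_pair: pair_sigma_finite unif unif ..

lemma AE_unif_iff: "(AE x in unif. P x) \<longleftrightarrow> (AE x in lborel. x \<in> {0..1} \<longrightarrow> P x)"
  by (subst AE_restrict_space_iff) auto

lemma measurable_unif_borel: "f \<in> borel_measurable borel \<Longrightarrow> f \<in> borel_measurable unif"
  by (intro measurable_restrict_space1) simp

lemma integral_unif: "integral\<^sup>L unif f = (LINT x:{0..1}|lborel. f x)" for f :: "real \<Rightarrow> real"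
  unfolding set_lebesgue_integral_def by (subst integral_restrict_space) auto

lemma copula_volume:
  assumes "is_copula C" "x \<in> {0..1}" "u \<in> {0..1}" "y \<in> {0..1}" "v \<in> {0..1}" "x \<le> u" "y \<le> v"
  shows "0 \<le> C u v - C u y - C x v + C x y"
  using assms unfolding is_copula_def by blast

lemma copula_margins:
  assumes "is_copula C" "x \<in> {0..1}"
  shows "C x 0 = 0" "C 0 x = 0" "C x 1 = x" "C 1 x = x"
  using assms unfolding is_copula_def by blast+

lemma copula_transposed:
  assumes C: "is_copula C" shows "is_copula (transposed C)"
  unfolding is_copula_def
proof (intro conjI ballI impI)
  fix u v :: real assume "u \<in> {0..1}" "v \<in> {0..1}"
  then show "C v u \<in> {0..1}"
    using C unfolding is_copula_def by blast
next
  fix x u y v :: real assume "x \<in> {0..1}" "u \<in> {0..1}" "y \<in> {0..1}" "v \<in> {0..1}" "x \<le> u" "y \<le> v"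
  then show "C v u - C y u - C v x + C y x \<ge> 0"
    using copula_volume[OF C, of y v x u] by simp
qed (simp_all add: copula_margins[OF C])

lemma copula_increment:
  assumes C: "is_copula C" and "x \<in> {0..1}" "u \<in> {0..1}" "y \<in> {0..1}" "x \<le> u"
  shows "C x y \<le> C u y" "C u y - C x y \<le> u - x"
proof -
  have "0 \<le> C u y - C u 0 - C x y + C x 0"
    by (rule copula_volume[OF C]) (use assms in auto)
  moreover have "0 \<le> C u 1 - C u y - C x 1 + C x y"
    by (rule copula_volume[OF C]) (use assms in auto)
  ultimately show "C x y \<le> C u y" "C u y - C x y \<le> u - x"
    using copula_margins[OF C] assms by simp_all
qed

lemma nonexpansive_mono_copula_slice:
  assumes C: "is_copula C" shows "nonexpansive_mono (\<lambda>s. C (clamp01 s) (clamp01 y))"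
  unfolding nonexpansive_mono_def
proof (intro allI impI)
  fix a b :: real assume "a \<le> b"
  then have "clamp01 a \<le> clamp01 b" "clamp01 b - clamp01 a \<le> b - a"
    by (auto intro: nonexpansive_mono_le[OF nonexpansive_mono_clamp01] nonexpansive_mono_diff_le[OF nonexpansive_mono_clamp01])
  then show "C (clamp01 a) (clamp01 y) \<le> C (clamp01 b) (clamp01 y) \<and>
      C (clamp01 b) (clamp01 y) - C (clamp01 a) (clamp01 y) \<le> b - a"
    using copula_increment[OF C, of "clamp01 a" "clamp01 b" "clamp01 y"] clamp01_range
    by (meson order_trans)
qed

lemma continuous_copula_clamped:
  assumes C: "is_copula C"
  shows "continuous_on UNIV (\<lambda>z. C (clamp01 (fst z)) (clamp01 (snd z)))"
proof -
  have "2-lipschitz_on UNIV (\<lambda>z. C (clamp01 (fst z)) (clamp01 (snd z)))"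
  proof (rule lipschitz_onI)
    fix z w :: "real \<times> real"
    have lip: "\<bar>F a - F b\<bar> \<le> \<bar>a - b\<bar>" if "nonexpansive_mono F" for F a b
      using nonexpansive_mono_le[OF that, of a b] nonexpansive_mono_diff_le[OF that, of a b]
        nonexpansive_mono_le[OF that, of b a] nonexpansive_mono_diff_le[OF that, of b a] by linarith
    have "\<bar>C (clamp01 (fst z)) (clamp01 (snd z)) - C (clamp01 (fst w)) (clamp01 (snd z))\<bar> \<le> \<bar>fst z - fst w\<bar>"
      using lip[OF nonexpansive_mono_copula_slice[OF C, of "snd z"], of "fst z" "fst w"] .
    moreover have "\<bar>C (clamp01 (fst w)) (clamp01 (snd z)) - C (clamp01 (fst w)) (clamp01 (snd w))\<bar> \<le> \<bar>snd z - snd w\<bar>"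
      using lip[OF nonexpansive_mono_copula_slice[OF copula_transposed[OF C], of "fst w"], of "snd z" "snd w"] .
    moreover have "\<bar>fst z - fst w\<bar> \<le> dist z w" "\<bar>snd z - snd w\<bar> \<le> dist z w"
      using dist_fst_le[of z w] dist_snd_le[of z w] by (auto simp: dist_real_def)
    ultimately show "dist (C (clamp01 (fst z)) (clamp01 (snd z))) (C (clamp01 (fst w)) (clamp01 (snd w))) \<le> 2 * dist z w"
      by (simp add: dist_real_def)
  qed simp
  then show ?thesis by (rule lipschitz_on_continuous_on)
qed

lemma borel_measurable_deriv1_pair:
  assumes "is_copula C"
  shows "(\<lambda>z. deriv1 C (fst z) (snd z)) \<in> borel_measurable borel"
  unfolding deriv1_def
  by (intro borel_measurable_vector_derivative_family continuous_copula_clamped nonexpansive_mono_copula_slice assms)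

lemma borel_measurable_deriv1:
  assumes C: "is_copula C"
  shows "(\<lambda>x. deriv1 C x y) \<in> borel_measurable borel" "(\<lambda>x. deriv1 C x y) \<in> borel_measurable unif"
    "(\<lambda>y. deriv1 C x y) \<in> borel_measurable unif"
    "(\<lambda>(x, y). deriv1 C x y) \<in> borel_measurable (unif \<Otimes>\<^sub>M unif)"
proof -
  note m = borel_measurable_deriv1_pair[OF C]
  have "(\<lambda>x. (\<lambda>z. deriv1 C (fst z) (snd z)) (x, y)) \<in> borel_measurable borel"
    by (rule measurable_compose[OF _ m]) auto
  then show "(\<lambda>x. deriv1 C x y) \<in> borel_measurable borel" by simp
  then show "(\<lambda>x. deriv1 C x y) \<in> borel_measurable unif" by (rule measurable_unif_borel)
  have "(\<lambda>y. (\<lambda>z. deriv1 C (fst z) (snd z)) (x, y)) \<in> borel_measurable borel"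
    by (rule measurable_compose[OF _ m]) auto
  then show "(\<lambda>y. deriv1 C x y) \<in> borel_measurable unif" by (intro measurable_unif_borel) simp
  have "(\<lambda>z. deriv1 C (fst z) (snd z)) \<in> borel_measurable (unif \<Otimes>\<^sub>M unif)"
  proof (rule measurable_compose[OF _ m])
    have "(\<lambda>z. (fst z, snd z)) \<in> borel_measurable (unif \<Otimes>\<^sub>M unif)"
      by (intro borel_measurable_Pair measurable_compose[OF measurable_fst] measurable_compose[OF measurable_snd]
          measurable_unif_borel) auto
    then show "(\<lambda>z. z) \<in> borel_measurable (unif \<Otimes>\<^sub>M unif)" by simp
  qed
  then show "(\<lambda>(x, y). deriv1 C x y) \<in> borel_measurable (unif \<Otimes>\<^sub>M unif)"
    by (simp add: case_prod_beta')
qed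

lemma deriv1_bounded:
  assumes "is_copula C" shows "\<exists>B. \<forall>x y. \<bar>deriv1 C x y\<bar> \<le> B"
  unfolding deriv1_def using abs_vector_derivative_nonexpansive_mono_le[OF nonexpansive_mono_copula_slice[OF assms]] by blast

lemma deriv1_AE_bounds:
  assumes "is_copula C"
  shows "AE x in unif. 0 \<le> deriv1 C x y \<and> deriv1 C x y \<le> 1"
proof -
  note F = nonexpansive_mono_copula_slice[OF assms, of y]
  have "AE x in lborel. 0 \<le> deriv1 C x y \<and> deriv1 C x y \<le> 1"
    using nonexpansive_mono_differentiable_AE[OF F]
    by eventually_elim (auto simp: deriv1_def vector_derivative_at intro: nonexpansive_mono_derivative_bounds[OF F])
  then show ?thesis unfolding AE_unif_iff by eventually_elim auto
qed

lemma deriv1_FTC: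
  assumes C: "is_copula C" and "a \<in> {0..1}" "y \<in> {0..1}"
  shows "(LINT x:{0..a}|lborel. deriv1 C x y) = C a y"
proof -
  have "(LINT x:{0..a}|lborel. deriv1 C x y) = C (clamp01 a) (clamp01 y) - C (clamp01 0) (clamp01 y)"
    unfolding deriv1_def by (rule nonexpansive_mono_FTC[OF nonexpansive_mono_copula_slice[OF C]]) (use assms in auto)
  also have "\<dots> = C a y"
    using assms copula_margins[OF C] by (simp add: clamp01_id)
  finally show ?thesis .
qed

lemma integral_deriv1:
  assumes "is_copula C" "y \<in> {0..1}"
  shows "(\<integral>x. deriv1 C x y \<partial>unif) = y"
  using deriv1_FTC[OF assms(1), of 1 y] assms copula_margins[OF assms(1)] by (simp add: integral_unif)

lemma integral_unif_id: "(\<integral>y. y \<partial>unif) = 1 / 2"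
proof -
  have "integral\<^sup>L lborel (\<lambda>x::real. indicator {0..1} x *\<^sub>R x) = 1\<^sup>2 / 2 - 0\<^sup>2 / 2"
    by (rule integral_FTC_atLeastAtMost)
      (auto intro!: derivative_eq_intros continuous_intros simp flip: has_real_derivative_iff_has_vector_derivative)
  then show ?thesis by (simp add: integral_unif set_lebesgue_integral_def)
qed

lemma integrable_deriv1:
  assumes C: "is_copula C"
  shows "integrable unif (\<lambda>x. deriv1 C x y)" "integrable unif (\<lambda>x. (deriv1 C x y)\<^sup>2)"
    "integrable (unif \<Otimes>\<^sub>M unif) (\<lambda>(x, y). (deriv1 C x y)\<^sup>2)"
    "integrable unif (\<lambda>y. \<integral>x. (deriv1 C x y)\<^sup>2 \<partial>unif)"
proof -
  obtain B where B: "\<And>x y. \<bar>deriv1 C x y\<bar> \<le> B" using deriv1_bounded[OF C] by blast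
  have B2: "(deriv1 C x y)\<^sup>2 \<le> B\<^sup>2" for x y using power_mono[OF B[of x y], of 2] by simp
  interpret P: finite_measure "unif \<Otimes>\<^sub>M unif"
    by (intro finite_measure_pair_measure finite_measure_unif)
  show "integrable unif (\<lambda>x. deriv1 C x y)"
    by (rule unif.integrable_const_bound[where B = B]) (use B borel_measurable_deriv1[OF C] in auto)
  show "integrable unif (\<lambda>x. (deriv1 C x y)\<^sup>2)"
    by (rule unif.integrable_const_bound[where B = "B\<^sup>2"]) (use B2 borel_measurable_deriv1[OF C] in auto)
  have "(\<lambda>z. ((\<lambda>(x, y). deriv1 C x y) z)\<^sup>2) \<in> borel_measurable (unif \<Otimes>\<^sub>M unif)"
    by (intro borel_measurable_power borel_measurable_deriv1 C)
  then show 1: "integrable (unif \<Otimes>\<^sub>M unif) (\<lambda>(x, y). (deriv1 C x y)\<^sup>2)"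
    by (intro P.integrable_const_bound[where B = "B\<^sup>2"]) (use B2 in \<open>auto simp: case_prod_beta'\<close>)
  show "integrable unif (\<lambda>y. \<integral>x. (deriv1 C x y)\<^sup>2 \<partial>unif)"
    using unif_pair.integrable_snd[OF 1] by simp
qed

text \<open>
  The energy falls short of 1/2 by the integral of \<open>\<partial>\<^sub>1C - (\<partial>\<^sub>1C)\<^sup>2\<close>, since \<open>\<partial>\<^sub>1C\<close> itself has integral
  \<open>C(1,y) = y\<close> in \<open>x\<close>, and 1/2 over the square.
\<close>

lemma energy_eq:
  assumes C: "is_copula C"
  shows "energy C = 1 / 2 - (\<integral>y. (\<integral>x. deriv1 C x y - (deriv1 C x y)\<^sup>2 \<partial>unif) \<partial>unif)"
    and "integrable unif (\<lambda>y. \<integral>x. deriv1 C x y - (deriv1 C x y)\<^sup>2 \<partial>unif)"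
proof -
  have eq: "(\<integral>x. deriv1 C x y - (deriv1 C x y)\<^sup>2 \<partial>unif) = y - (\<integral>x. (deriv1 C x y)\<^sup>2 \<partial>unif)"
    if "y \<in> {0..1}" for y
    by (subst Bochner_Integration.integral_diff) (use integrable_deriv1[OF C] integral_deriv1[OF C that] in auto)
  have id: "integrable unif (\<lambda>y. y)"
    by (rule unif.integrable_const_bound[where B = 1]) (auto intro!: AE_I2 measurable_unif_borel)
  have i: "integrable unif (\<lambda>y. y - (\<integral>x. (deriv1 C x y)\<^sup>2 \<partial>unif))"
    using id integrable_deriv1(4)[OF C] by (rule Bochner_Integration.integrable_diff)
  show "integrable unif (\<lambda>y. \<integral>x. deriv1 C x y - (deriv1 C x y)\<^sup>2 \<partial>unif)"
    using i by (rule Bochner_Integration.integrable_cong[THEN iffD1, rotated 2]) (auto simp: eq)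
  have "(\<integral>y. (\<integral>x. deriv1 C x y - (deriv1 C x y)\<^sup>2 \<partial>unif) \<partial>unif) =
      (\<integral>y. y - (\<integral>x. (deriv1 C x y)\<^sup>2 \<partial>unif) \<partial>unif)"
    by (rule Bochner_Integration.integral_cong) (auto simp: eq)
  also have "\<dots> = 1 / 2 - energy C"
    using id integrable_deriv1(4)[OF C] integral_unif_id by (simp add: energy_def)
  finally show "energy C = 1 / 2 - (\<integral>y. (\<integral>x. deriv1 C x y - (deriv1 C x y)\<^sup>2 \<partial>unif) \<partial>unif)"
    by simp
qed

lemma deriv1_defect_nonneg:
  assumes C: "is_copula C"
  shows "AE x in unif. 0 \<le> deriv1 C x y - (deriv1 C x y)\<^sup>2"
    and "0 \<le> (\<integral>x. deriv1 C x y - (deriv1 C x y)\<^sup>2 \<partial>unif)"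
proof -
  show "AE x in unif. 0 \<le> deriv1 C x y - (deriv1 C x y)\<^sup>2"
    using deriv1_AE_bounds[OF C, of y]
    by eventually_elim (auto simp: power2_eq_square mult_left_le_one_le)
  then show "0 \<le> (\<integral>x. deriv1 C x y - (deriv1 C x y)\<^sup>2 \<partial>unif)"
    by (rule integral_nonneg_AE)
qed

lemma energy_le_half:
  assumes C: "is_copula C" shows "energy C \<le> 1 / 2"
proof -
  have "0 \<le> (\<integral>y. (\<integral>x. deriv1 C x y - (deriv1 C x y)\<^sup>2 \<partial>unif) \<partial>unif)"
    by (intro integral_nonneg_AE AE_I2 deriv1_defect_nonneg(2)[OF C])
  then show ?thesis by (simp add: energy_eq[OF C])
qed

lemma energy_half_imp_deriv1_01:
  assumes C: "is_copula C" and e: "energy C = 1 / 2"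
  shows "AE y in unif. AE x in unif. deriv1 C x y \<in> {0, 1}"
proof -
  have "(\<integral>y. (\<integral>x. deriv1 C x y - (deriv1 C x y)\<^sup>2 \<partial>unif) \<partial>unif) = 0"
    using e energy_eq(1)[OF C] by simp
  then have "AE y in unif. (\<integral>x. deriv1 C x y - (deriv1 C x y)\<^sup>2 \<partial>unif) = 0"
    by (subst (asm) integral_nonneg_eq_0_iff_AE) (use energy_eq(2)[OF C] deriv1_defect_nonneg(2)[OF C] in auto)
  then show ?thesis
  proof eventually_elim
    case (elim y)
    then have "AE x in unif. deriv1 C x y - (deriv1 C x y)\<^sup>2 = 0"
      by (subst (asm) integral_nonneg_eq_0_iff_AE)
        (use integrable_deriv1[OF C] deriv1_defect_nonneg(1)[OF C] in auto)
    then show ?case by eventually_elim (auto simp: power2_eq_square)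
  qed
qed


section \<open>The Sobolev norm as a sum of two energies\<close>

lemma partial1_eq_deriv1:
  assumes "0 < x" "x < 1" "y \<in> {0..1}"
  shows "partial1 C x y = deriv1 C x y"
proof -
  have "partial1 C x y = vector_derivative (\<lambda>s. C s y) (at x)"
    unfolding partial1_def using assms by (simp add: at_within_Icc_at)
  also have "\<dots> = vector_derivative (\<lambda>s. C (clamp01 s) (clamp01 y)) (at x)"
  proof (rule vector_derivative_cong_eq)
    have "eventually (\<lambda>s. s \<in> {0<..<1}) (nhds x)"
      using assms by (intro eventually_nhds_in_open) auto
    then show "eventually (\<lambda>s. s \<in> UNIV \<longrightarrow> C s y = C (clamp01 s) (clamp01 y)) (nhds x)"
      by eventually_elim (use assms in \<open>auto simp: clamp01_id\<close>)
  qed auto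
  finally show ?thesis by (simp add: deriv1_def)
qed

lemma partial2_eq_deriv1:
  assumes "x \<in> {0..1}" "0 < y" "y < 1"
  shows "partial2 C x y = deriv1 (transposed C) y x"
  using partial1_eq_deriv1[of y x "transposed C"] assms by (simp add: partial1_def partial2_def)

text \<open>
  Applied to \<^const>\<open>partial1\<close> and \<^const>\<open>partial2\<close>, whose measurability itself comes from such a
  comparison with \<^term>\<open>deriv1 C\<close>; almost everywhere equality would presuppose it.
\<close>

lemma integral_unif_cong_interior:
  fixes f g :: "real \<Rightarrow> real"
  assumes "\<And>x. 0 < x \<Longrightarrow> x < 1 \<Longrightarrow> f x = g x"
  shows "integral\<^sup>L unif f = integral\<^sup>L unif g"
proof (rule integral_discrete_difference[where X = "{0, 1}"])
  show "emeasure unif {x} = 0" "{x} \<in> sets unif" if "x \<in> {0, 1}" for x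
    using that by (auto simp: emeasure_unif sets_unif)
  show "f x = g x" if "x \<in> space unif" "x \<notin> {0, 1}" for x
    using that by (intro assms) auto
qed simp

lemma sobolev_norm_eq:
  assumes C: "is_copula C"
  shows "sobolev_norm C = sqrt (energy C + energy (transposed C))"
proof -
  note C' = copula_transposed[OF C]
  have "(LINT y:{0..1}|lborel. LINT x:{0..1}|lborel. (partial1 C x y)\<^sup>2 + (partial2 C x y)\<^sup>2)
    = (\<integral>y. (\<integral>x. (partial1 C x y)\<^sup>2 + (partial2 C x y)\<^sup>2 \<partial>unif) \<partial>unif)"
    by (simp add: integral_unif)
  also have "\<dots> = (\<integral>y. (\<integral>x. (deriv1 C x y)\<^sup>2 + (deriv1 (transposed C) y x)\<^sup>2 \<partial>unif) \<partial>unif)"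
    by (intro integral_unif_cong_interior) (simp add: partial1_eq_deriv1 partial2_eq_deriv1)
  also have "\<dots> = (\<integral>y. (\<integral>x. (deriv1 C x y)\<^sup>2 \<partial>unif) + (\<integral>x. (deriv1 (transposed C) y x)\<^sup>2 \<partial>unif) \<partial>unif)"
  proof (intro Bochner_Integration.integral_cong refl Bochner_Integration.integral_add)
    show "integrable unif (\<lambda>x. (deriv1 C x y)\<^sup>2)" for y by (rule integrable_deriv1[OF C])
    obtain B where B: "\<And>x y. \<bar>deriv1 (transposed C) x y\<bar> \<le> B" using deriv1_bounded[OF C'] by blast
    show "integrable unif (\<lambda>x. (deriv1 (transposed C) y x)\<^sup>2)" for y
      using power_mono[OF B abs_ge_zero, of _ _ 2]
      by (intro unif.integrable_const_bound[where B = "B\<^sup>2"] borel_measurable_power borel_measurable_deriv1[OF C']) auto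
  qed
  also have "\<dots> = energy C + (\<integral>y. (\<integral>x. (deriv1 (transposed C) y x)\<^sup>2 \<partial>unif) \<partial>unif)"
    unfolding energy_def
    using integrable_deriv1(4)[OF C] unif_pair.integrable_fst'[OF integrable_deriv1(3)[OF C']]
    by (subst Bochner_Integration.integral_add) simp_all
  also have "(\<integral>y. (\<integral>x. (deriv1 (transposed C) y x)\<^sup>2 \<partial>unif) \<partial>unif) = energy (transposed C)"
    unfolding energy_def using unif_pair.Fubini_integral[OF integrable_deriv1(3)[OF C']] by simp
  finally show ?thesis by (simp add: sobolev_norm_def)
qed

lemma sobolev_norm_eq_1_iff:
  assumes C: "is_copula C"
  shows "sobolev_norm C = 1 \<longleftrightarrow> energy C = 1 / 2 \<and> energy (transposed C) = 1 / 2"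
  using energy_le_half[OF C] energy_le_half[OF copula_transposed[OF C]]
  by (auto simp: sobolev_norm_eq[OF C] real_sqrt_eq_1_iff)

section \<open>Maximal energy means mass on the graph of a function\<close>

text \<open>
  The functions are densities of finite measures on the line which agree on all half-lines.
\<close>

lemma AE_eq_if_primitives_eq:
  fixes f g :: "real \<Rightarrow> real"
  assumes f: "integrable unif f" "AE x in unif. 0 \<le> f x"
    and g: "integrable unif g" "AE x in unif. 0 \<le> g x"
    and eq: "\<And>a. a \<in> {0..1} \<Longrightarrow> (LINT x:{0..a}|lborel. f x) = (LINT x:{0..a}|lborel. g x)"
  shows "AE x in unif. f x = g x"
proof -
  define N where "N f = density lborel (\<lambda>x. ennreal (indicator {0..1} x * f x))" for f :: "real \<Rightarrow> real"
  have int: "integrable lborel (\<lambda>x. indicator {0..1} x * f x)" if "integrable unif f" for f :: "real \<Rightarrow> real"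
    using that by (subst (asm) integrable_restrict_space) auto
  have em: "emeasure (N f) {t<..} =
      ennreal ((LINT x:{0..1}|lborel. f x) - (if t < 0 then 0 else LINT x:{0..min t 1}|lborel. f x))"
    if f: "integrable unif f" "AE x in unif. 0 \<le> f x" for f t
  proof -
    let ?f = "\<lambda>x. indicator {0..1} x * f x"
    note i = int[OF f(1)]
    have m: "?f \<in> borel_measurable borel" using borel_measurable_integrable[OF i] by simp
    have nn: "AE x in lborel. 0 \<le> ?f x * indicator {t<..} x"
      using f(2) unfolding AE_unif_iff by eventually_elim (auto split: split_indicator)
    have "emeasure (N f) {t<..} = (\<integral>\<^sup>+x. ennreal (?f x) * indicator {t<..} x \<partial>lborel)"
      unfolding N_def using m by (intro emeasure_density) auto
    also have "\<dots> = (\<integral>\<^sup>+x. ennreal (?f x * indicator {t<..} x) \<partial>lborel)"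
      by (intro nn_integral_cong) (auto split: split_indicator)
    also have "\<dots> = ennreal (\<integral>x. ?f x * indicator {t<..} x \<partial>lborel)"
      using nn i by (intro nn_integral_eq_integral integrable_real_mult_indicator) auto
    also have "(\<integral>x. ?f x * indicator {t<..} x \<partial>lborel) =
        (\<integral>x. ?f x - (if t < 0 then 0 else indicator {0..min t 1} x * f x) \<partial>lborel)"
      by (intro Bochner_Integration.integral_cong) (auto split: split_indicator)
    also have "\<dots> = (\<integral>x. ?f x \<partial>lborel) - (\<integral>x. (if t < 0 then 0 else indicator {0..min t 1} x * f x) \<partial>lborel)"
    proof (rule Bochner_Integration.integral_diff[OF i])
      have "integrable lborel (\<lambda>x. ?f x * indicator {0..min t 1} x)"
        by (rule integrable_real_mult_indicator[OF _ i]) simp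
      moreover have "?f x * indicator {0..min t 1} x = indicator {0..min t 1} x * f x" for x
        by (auto split: split_indicator)
      ultimately show "integrable lborel (\<lambda>x. if t < 0 then 0 else indicator {0..min t 1} x * f x)"
        by (cases "t < 0") simp_all
    qed
    finally show ?thesis by (simp add: set_lebesgue_integral_def)
  qed
  have "N f = N g"
  proof (rule measure_eqI_lessThan)
    show "emeasure (N f) {t<..} < \<infinity>" for t using em[OF f, of t] by simp
    show "emeasure (N f) {t<..} = emeasure (N g) {t<..}" for t
    proof -
      have "(if t < 0 then 0 else LINT x:{0..min t 1}|lborel. f x) = (if t < 0 then 0 else LINT x:{0..min t 1}|lborel. g x)"
        using eq[of "min t 1"] by simp
      then show ?thesis unfolding em[OF f] em[OF g] using eq[of 1] by simp
    qed
  qed (auto simp: N_def)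
  then have "AE x in lborel. ennreal (indicator {0..1} x * f x) = ennreal (indicator {0..1} x * g x)"
    using borel_measurable_integrable[OF int[OF f(1)]] borel_measurable_integrable[OF int[OF g(1)]]
    unfolding N_def by (intro sigma_finite_measure.density_unique[OF sigma_finite_lborel]) auto
  moreover have "AE x in lborel. x \<in> {0..1} \<longrightarrow> 0 \<le> f x" "AE x in lborel. x \<in> {0..1} \<longrightarrow> 0 \<le> g x"
    using f(2) g(2) by (simp_all only: AE_unif_iff)
  ultimately show ?thesis unfolding AE_unif_iff
    by eventually_elim auto
qed

lemma measure_unif: "A \<subseteq> {0..1} \<Longrightarrow> measure unif A = measure lborel A"
  by (simp add: measure_def emeasure_unif)

text \<open>
  For fixed \<open>y\<close>, the function \<open>C a y\<close> of \<open>a\<close> is the primitive both of \<open>\<partial>\<^sub>1C\<close> and of the indicator of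
  \<open>{g \<le> y}\<close>. So the derivative is this indicator, and it equals its square.
\<close>

lemma energy_half_if_carried_by_graph:
  assumes C: "is_copula C" and g: "carried_by_graph C g"
  shows "energy C = 1 / 2"
proof -
  have gm: "g \<in> unif \<rightarrow>\<^sub>M unif" and gC: "\<And>x y. x \<in> {0..1} \<Longrightarrow> y \<in> {0..1} \<Longrightarrow>
      C x y = measure unif {s\<in>{0..1}. s \<le> x \<and> g s \<le> y}"
    using g unfolding carried_by_graph_def by auto
  have sq: "(\<integral>x. (deriv1 C x y)\<^sup>2 \<partial>unif) = y" if y: "y \<in> {0..1}" for y
  proof -
    have "{s\<in>space unif. g s \<le> y} \<in> sets unif"
    proof -
      have "{0..y} \<in> sets unif" using y by (auto simp: sets_unif)
      then have "g -` {0..y} \<inter> space unif \<in> sets unif" by (rule measurable_sets[OF gm])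
      moreover have "g s \<in> {0..1}" if "s \<in> space unif" for s
        using measurable_space[OF gm that] by simp
      then have "g -` {0..y} \<inter> space unif = {s\<in>space unif. g s \<le> y}" by fastforce
      ultimately show ?thesis by simp
    qed
    define A where "A = {s\<in>{0..1}. g s \<le> y}"
    have A: "A \<in> sets unif" "A \<subseteq> {0..1}" "A \<in> sets borel"
      using \<open>{s\<in>space unif. g s \<le> y} \<in> sets unif\<close> by (auto simp: A_def sets_unif)
    have "AE x in unif. deriv1 C x y = indicator A x"
    proof (rule AE_eq_if_primitives_eq)
      show "AE x in unif. 0 \<le> deriv1 C x y" using deriv1_AE_bounds[OF C] by eventually_elim auto
      show "integrable unif (indicator A :: real \<Rightarrow> real)"
        using A by (intro integrable_real_indicator) (auto simp: unif.emeasure_finite less_top[symmetric])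
      fix a :: real assume a: "a \<in> {0..1}"
      have "(LINT x:{0..a}|lborel. indicator A x :: real) = (\<integral>x. indicator (A \<inter> {0..a}) x \<partial>lborel)"
        unfolding set_lebesgue_integral_def
        by (intro Bochner_Integration.integral_cong) (auto split: split_indicator)
      also have "\<dots> = measure lborel (A \<inter> {0..a})" by simp
      also have "\<dots> = measure unif {s\<in>{0..1}. s \<le> a \<and> g s \<le> y}"
      proof -
        have "A \<inter> {0..a} = {s\<in>{0..1}. s \<le> a \<and> g s \<le> y}" using a by (auto simp: A_def)
        moreover have "A \<inter> {0..a} \<subseteq> {0..1}" using A(2) by blast
        ultimately show ?thesis by (metis measure_unif)
      qed
      also have "\<dots> = C a y" using gC a y by simp
      finally show "(LINT x:{0..a}|lborel. deriv1 C x y) = (LINT x:{0..a}|lborel. indicator A x)"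
        using deriv1_FTC[OF C a y] by simp
    qed (auto intro: integrable_deriv1[OF C])
    then have "AE x in unif. (deriv1 C x y)\<^sup>2 = deriv1 C x y"
      by eventually_elim (auto split: split_indicator)
    then have "(\<integral>x. (deriv1 C x y)\<^sup>2 \<partial>unif) = (\<integral>x. deriv1 C x y \<partial>unif)"
      by (intro integral_cong_AE) (auto intro!: borel_measurable_power borel_measurable_deriv1[OF C])
    then show ?thesis using integral_deriv1[OF C y] by simp
  qed
  have "energy C = (\<integral>y. y \<partial>unif)"
    unfolding energy_def by (intro Bochner_Integration.integral_cong) (auto simp: sq)
  then show ?thesis by (simp add: integral_unif_id)
qed

text \<open>
  By the rectangle inequality, \<open>C s y - C s z\<close> increases with \<open>s\<close>.
\<close>

lemma deriv1_mono_AE: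
  assumes C: "is_copula C" and z: "z \<in> {0..1}" "y \<in> {0..1}" "z \<le> y"
  shows "AE x in unif. deriv1 C x z \<le> deriv1 C x y"
proof -
  note Fy = nonexpansive_mono_copula_slice[OF C, of y] and Fz = nonexpansive_mono_copula_slice[OF C, of z]
  let ?G = "\<lambda>s. C (clamp01 s) (clamp01 y) - C (clamp01 s) (clamp01 z)"
  have mono: "?G a \<le> ?G b" if "a \<le> b" for a b
  proof -
    have "0 \<le> C (clamp01 b) (clamp01 y) - C (clamp01 b) (clamp01 z) - C (clamp01 a) (clamp01 y) + C (clamp01 a) (clamp01 z)"
      by (rule copula_volume[OF C]) (use clamp01_range that nonexpansive_mono_le[OF nonexpansive_mono_clamp01] z in auto)
    then show ?thesis by simp
  qed
  have "AE x in lborel. deriv1 C x z \<le> deriv1 C x y"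
    using nonexpansive_mono_differentiable_AE[OF Fy] nonexpansive_mono_differentiable_AE[OF Fz]
  proof eventually_elim
    case (elim x)
    then obtain D E where
      D: "((\<lambda>s. C (clamp01 s) (clamp01 y)) has_vector_derivative D) (at x)" and
      E: "((\<lambda>s. C (clamp01 s) (clamp01 z)) has_vector_derivative E) (at x)" by blast
    have "(?G has_real_derivative D - E) (at x)"
      unfolding has_real_derivative_iff_has_vector_derivative using D E
      by (rule has_vector_derivative_diff)
    then have "((\<lambda>h. (?G (x + h) - ?G x) / h) \<longlongrightarrow> D - E) (at 0)"
      by (simp only: DERIV_def)
    moreover have "eventually (\<lambda>h. 0 \<le> (?G (x + h) - ?G x) / h) (at 0)"
    proof (intro eventuallyI[THEN eventually_at_filter[THEN iffD2]] impI)
      fix h :: real assume "h \<noteq> 0"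
      then show "0 \<le> (?G (x + h) - ?G x) / h"
        using mono[of x "x + h"] mono[of "x + h" x]
        by (cases "0 < h") (auto simp: zero_le_divide_iff)
    qed
    ultimately have "0 \<le> D - E"
      by (rule tendsto_lowerbound) simp
    then show ?case
      unfolding deriv1_def vector_derivative_at[OF D] vector_derivative_at[OF E] by simp
  qed
  then show ?thesis unfolding AE_unif_iff by eventually_elim simp
qed

lemma AE_unif_dense:
  assumes "AE y in unif. P y" "0 \<le> a" "a < b" "b \<le> 1"
  shows "\<exists>y. a < y \<and> y < b \<and> P y"
proof (rule ccontr)
  assume n: "\<not> ?thesis"
  have "AE y in lborel. y \<notin> {a<..<b}"
    using assms(1) unfolding AE_unif_iff by eventually_elim (use n assms in auto)
  then have "{a<..<b} \<in> null_sets lborel"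
    by (subst AE_iff_null_sets) auto
  then have "emeasure lborel {a<..<b} = 0" by auto
  then show False using assms by simp
qed

text \<open>
  For almost every \<open>s\<close>, the function \<open>\<partial>\<^sub>1C(s, \<cdot>)\<close> is an increasing 0-1 function on a countable dense set
  \<open>Y\<close> of levels, and \<open>g s\<close> is the level where it jumps. The distribution function of \<open>(s, g s)\<close> at \<open>(x, t)\<close>
  lies between \<open>C x y\<close> and \<open>C x y'\<close> for all levels \<open>y \<le> t < y'\<close> in \<open>Y\<close>, and \<open>C\<close> is
  continuous.
\<close>

lemma carried_by_graph_if_energy_half:
  assumes C: "is_copula C" and e: "energy C = 1 / 2"
  shows "\<exists>g. carried_by_graph C g"
proof -
  note good = energy_half_imp_deriv1_01[OF C e]
  define pick where "pick = (\<lambda>(p::rat, q::rat). SOME y. real_of_rat p < y \<and> y < real_of_rat q \<and>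
      (AE x in unif. deriv1 C x y \<in> {0, 1}))"
  define Y where "Y = pick ` {(p, q). 0 \<le> p \<and> p < q \<and> q \<le> 1}"
  have pick: "real_of_rat p < pick (p, q) \<and> pick (p, q) < real_of_rat q \<and>
      (AE x in unif. deriv1 C x (pick (p, q)) \<in> {0, 1})" if "0 \<le> p" "p < q" "q \<le> 1" for p q
    unfolding pick_def prod.case
    by (rule someI_ex, rule AE_unif_dense[OF good]) (use that in \<open>auto simp: of_rat_less\<close>)
  have "countable Y" unfolding Y_def by (intro countable_image) simp
  have Y01: "y \<in> {0..1}" and YAE: "AE x in unif. deriv1 C x y \<in> {0, 1}" if "y \<in> Y" for y
  proof -
    obtain p q :: rat where pq: "y = pick (p, q)" "0 \<le> p" "p < q" "q \<le> 1" using \<open>y \<in> Y\<close> by (auto simp: Y_def)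
    then have "0 \<le> (real_of_rat p :: real)" "real_of_rat q \<le> (1 :: real)" by auto
    then show "y \<in> {0..1}" "AE x in unif. deriv1 C x y \<in> {0, 1}"
      using pick[OF pq(2-4)] unfolding pq(1) atLeastAtMost_iff by linarith+
  qed
  have dense: "\<exists>y\<in>Y. a < y \<and> y < b" if ab: "0 \<le> a" "a < b" "b \<le> 1" for a b
  proof -
    obtain p where p: "a < real_of_rat p" "real_of_rat p < b" using of_rat_dense[OF ab(2)] by blast
    obtain q where q: "real_of_rat p < real_of_rat q" "real_of_rat q < b" using of_rat_dense[OF p(2)] by blast
    have "0 < (real_of_rat p :: real)" "real_of_rat q < (1 :: real)" using p q ab by linarith+
    then have pq: "0 \<le> p" "p < q" "q \<le> 1" using q by (auto simp: of_rat_less)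
    then have "pick (p, q) \<in> Y" by (auto simp: Y_def)
    then show ?thesis using pick[OF pq] p q by (intro bexI[of _ "pick (p, q)"]) auto
  qed
  \<comment> \<open>The 1 keeps the set nonempty, so that \<open>g\<close> takes values in the unit interval everywhere.\<close>
  define g where "g s = Inf (insert 1 {y\<in>Y. deriv1 C s y = 1})" for s
  have bdd: "bdd_below (insert 1 {y\<in>Y. deriv1 C s y = 1})" for s
    using Y01 by (intro bdd_belowI[of _ 0]) auto
  have g_le: "g s \<le> y" if "y \<in> Y" "deriv1 C s y = 1" for s y
    unfolding g_def using that by (intro cInf_lower bdd) auto
  have g_less: "g s < t \<longleftrightarrow> 1 < t \<or> (\<exists>y\<in>Y. y < t \<and> deriv1 C s y = 1)" for s t
    unfolding g_def by (subst cInf_less_iff[OF _ bdd]) auto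
  have g01: "g s \<in> {0..1}" for s
  proof -
    have "0 \<le> g s" unfolding g_def by (rule cInf_greatest) (use Y01 in auto)
    moreover have "g s \<le> 1" unfolding g_def by (rule cInf_lower[OF _ bdd]) simp
    ultimately show ?thesis by simp
  qed
  have "g \<in> borel_measurable borel"
    unfolding borel_measurable_iff_less
  proof
    fix t
    have "{s. deriv1 C s y = 1} \<in> sets borel" for y
      using measurable_sets[OF borel_measurable_deriv1(1)[OF C], of "{1}" y] by (simp add: vimage_def)
    then have "(\<Union>y\<in>{y\<in>Y. y < t}. {s. deriv1 C s y = 1}) \<in> sets borel"
      using \<open>countable Y\<close> by (intro sets.countable_UN'') auto
    moreover have "{s \<in> space borel. g s < t} =
        (if 1 < t then UNIV else \<Union>y\<in>{y\<in>Y. y < t}. {s. deriv1 C s y = 1})"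
      unfolding g_less by auto
    ultimately show "{s \<in> space borel. g s < t} \<in> sets borel" by simp
  qed
  then have g_meas: "g \<in> unif \<rightarrow>\<^sub>M unif"
  proof (intro measurable_restrict_space2)
    show "g \<in> space unif \<rightarrow> {0..1}" using g01 by blast
    show "g \<in> unif \<rightarrow>\<^sub>M lborel"
      using measurable_unif_borel[OF \<open>g \<in> borel_measurable borel\<close>] by simp
  qed
  have g_sets: "{s\<in>{0..1}. s \<le> x \<and> g s \<le> y} \<in> sets unif" for x y
    using \<open>g \<in> borel_measurable borel\<close> by (auto simp: sets_unif)
  have d_sets: "{s\<in>{0..1}. s \<le> x \<and> deriv1 C s y = 1} \<in> sets unif" for x y
    using borel_measurable_deriv1(1)[OF C] by (auto simp: sets_unif)
  have C_eq: "C x y = measure unif {s\<in>{0..1}. s \<le> x \<and> deriv1 C s y = 1}"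
    if "x \<in> {0..1}" "y \<in> Y" for x y
  proof -
    have "C x y = (LINT s:{0..x}|lborel. deriv1 C s y)" using deriv1_FTC[OF C] that Y01 by simp
    also have "\<dots> = (\<integral>s. indicator {0..x} s * deriv1 C s y \<partial>unif)"
      unfolding integral_unif set_lebesgue_integral_def
      using that by (intro Bochner_Integration.integral_cong) (auto split: split_indicator)
    also have "\<dots> = (\<integral>s. indicator {s\<in>{0..1}. s \<le> x \<and> deriv1 C s y = 1} s \<partial>unif)"
    proof (rule integral_cong_AE)
      show "AE s in unif. indicator {0..x} s * deriv1 C s y = indicator {s\<in>{0..1}. s \<le> x \<and> deriv1 C s y = 1} s"
        using YAE[OF that(2)] AE_space by eventually_elim (auto split: split_indicator)
    qed (use borel_measurable_deriv1(1)[OF C] d_sets in \<open>auto intro!: borel_measurable_times measurable_unif_borel\<close>)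
    also have "\<dots> = measure unif {s\<in>{0..1}. s \<le> x \<and> deriv1 C s y = 1}"
    proof -
      have "{s\<in>{0..1}. s \<le> x \<and> deriv1 C s y = 1} \<inter> space unif = {s\<in>{0..1}. s \<le> x \<and> deriv1 C s y = 1}"
        by auto
      then show ?thesis by simp
    qed
    finally show ?thesis .
  qed
  have lower: "C x y \<le> measure unif {s\<in>{0..1}. s \<le> x \<and> g s \<le> t}"
    if "x \<in> {0..1}" "y \<in> Y" "y \<le> t" for x y t
    unfolding C_eq[OF that(1,2)]
    by (rule unif.finite_measure_mono[OF _ g_sets]) (use g_le that in force)
  have upper: "measure unif {s\<in>{0..1}. s \<le> x \<and> g s \<le> t} \<le> C x y"
    if x: "x \<in> {0..1}" and y: "y \<in> Y" "t < y" for x y t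
    unfolding C_eq[OF x y(1)]
  proof (rule unif.finite_measure_mono_AE[OF _ d_sets])
    have "AE s in unif. \<forall>z\<in>Y. z \<le> y \<longrightarrow> deriv1 C s z \<le> deriv1 C s y"
      using deriv1_mono_AE[OF C Y01 Y01[OF y(1)]] \<open>countable Y\<close> by (intro AE_ball_countable') auto
    with YAE[OF y(1)]
    show "AE s in unif. s \<in> {s\<in>{0..1}. s \<le> x \<and> g s \<le> t} \<longrightarrow> s \<in> {s\<in>{0..1}. s \<le> x \<and> deriv1 C s y = 1}"
    proof eventually_elim
      case (elim s)
      show ?case
      proof
        assume s: "s \<in> {s\<in>{0..1}. s \<le> x \<and> g s \<le> t}"
        then have "g s < y" using y by auto
        then obtain z where "z \<in> Y" "z < y" "deriv1 C s z = 1"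
          using g_less[of s y] Y01[OF y(1)] by auto
        then show "s \<in> {s\<in>{0..1}. s \<le> x \<and> deriv1 C s y = 1}" using elim s by force
      qed
    qed
  qed
  have "C x t = measure unif {s\<in>{0..1}. s \<le> x \<and> g s \<le> t}" (is "_ = ?m")
    if x: "x \<in> {0..1}" and t: "t \<in> {0..1}" for x t
  proof (rule antisym)
    show "C x t \<le> ?m"
    proof (cases "t = 0")
      case False
      show ?thesis
      proof (rule field_le_epsilon)
        fix e :: real assume "0 < e"
        then obtain y where y: "y \<in> Y" "max 0 (t - e) < y" "y < t"
          using dense[of "max 0 (t - e)" t] False t by auto
        have "C x t - C x y \<le> t - y"
          using copula_increment(2)[OF copula_transposed[OF C], of y t x] x t y Y01[OF y(1)] by simp
        then show "C x t \<le> ?m + e" using lower[OF x y(1), of t] y by simp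
      qed
    qed (use copula_margins[OF C] x in simp)
    show "?m \<le> C x t"
    proof (cases "t = 1")
      case False
      show ?thesis
      proof (rule field_le_epsilon)
        fix e :: real assume "0 < e"
        then obtain y where y: "y \<in> Y" "t < y" "y < min 1 (t + e)"
          using dense[of t "min 1 (t + e)"] False t by auto
        have "C x y - C x t \<le> y - t"
          using copula_increment(2)[OF copula_transposed[OF C], of t y x] x t y Y01[OF y(1)] by simp
        then show "?m \<le> C x t + e" using upper[OF x y(1), of t] y by simp
      qed
    next
      case True
      have "{s\<in>{0..1}. s \<le> x \<and> g s \<le> t} = {0..x}" using True g01 x by auto
      then have "?m = x" using x by (simp add: measure_def emeasure_unif)
      then show ?thesis using True copula_margins[OF C] x by simp
    qed
  qed
  then show ?thesis using g_meas unfolding carried_by_graph_def by blast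
qed


section \<open>The measure of a copula\<close>

abbreviation square_borel :: "(real \<times> real) measure" where
  "square_borel \<equiv> restrict_space borel unit_square"

definition rectangles :: "(real \<times> real) set set" where
  "rectangles = {{x..u} \<times> {y..v} | x u y v. 0 \<le> x \<and> x \<le> u \<and> u \<le> 1 \<and> 0 \<le> y \<and> y \<le> v \<and> v \<le> 1}"

lemma rectanglesI:
  "\<lbrakk>0 \<le> x; x \<le> u; u \<le> 1; 0 \<le> y; y \<le> v; v \<le> 1\<rbrakk> \<Longrightarrow> {x..u} \<times> {y..v} \<in> rectangles"
  unfolding rectangles_def by blast

lemma rectangles_subset: "rectangles \<subseteq> Pow unit_square"
  by (auto simp: rectangles_def)

lemma sets_square_borel: "sets square_borel = sigma_sets unit_square rectangles"
proof -
  let ?I = "{(x::real, u, y::real, v). 0 \<le> x \<and> x \<le> u \<and> u \<le> 1 \<and> 0 \<le> y \<and> y \<le> v \<and> v \<le> 1}"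
  let ?G = "\<lambda>(x::real, u, y::real, v). {x..u} \<times> {y..v}"
  have eq: "?G ` ?I = rectangles"
    unfolding rectangles_def by (auto simp: image_iff)
  have "sets (copula_measure min) = sigma_sets unit_square (?G ` ?I)"
    unfolding copula_measure_def
    by (rule sets_extend_measure) (use eq rectangles_subset in simp)
  then show ?thesis using sets_copula_measure[of min] eq by simp
qed

lemma space_square_borel: "space square_borel = unit_square"
  by (simp add: space_restrict_space)

lemma rectangle_in_sets: "{x..u} \<times> {y..v} \<in> sets square_borel"
  if "0 \<le> x" "u \<le> 1" "0 \<le> y" "v \<le> 1"
proof -
  have "{x..u} \<times> {y..v} \<in> sets (borel :: (real \<times> real) measure)"
    by (intro borel_closed closed_Times) auto
  moreover have "{x..u} \<times> {y..v} \<subseteq> unit_square" using that by auto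
  moreover have "unit_square \<in> sets (borel :: (real \<times> real) measure)"
    by (intro borel_closed closed_Times) auto
  ultimately show ?thesis by (subst sets_restrict_space_iff) auto
qed

lemma measure_eqI_rectangles:
  assumes M: "sets M = sets square_borel" and N: "sets N = sets square_borel"
    and fin: "emeasure M unit_square \<noteq> \<infinity>"
    and eq: "\<And>x u y v. \<lbrakk>0 \<le> x; x \<le> u; u \<le> 1; 0 \<le> y; y \<le> v; v \<le> 1\<rbrakk> \<Longrightarrow>
      emeasure M ({x..u} \<times> {y..v}) = emeasure N ({x..u} \<times> {y..v})"
  shows "M = N"
proof (rule measure_eqI_generator_eq[where E = "insert {} rectangles" and \<Omega> = unit_square
      and A = "\<lambda>_. unit_square"])
  show "Int_stable (insert {} rectangles)"
  proof (rule Int_stableI)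
    fix A B assume "A \<in> insert {} rectangles" "B \<in> insert {} rectangles"
    then consider "A \<inter> B = {}" | x u y v x' u' y' v' where
      "A = {x..u} \<times> {y..v}" "0 \<le> x" "x \<le> u" "u \<le> 1" "0 \<le> y" "y \<le> v" "v \<le> 1"
      "B = {x'..u'} \<times> {y'..v'}" "0 \<le> x'" "x' \<le> u'" "u' \<le> 1" "0 \<le> y'" "y' \<le> v'" "v' \<le> 1"
      unfolding rectangles_def by blast
    then show "A \<inter> B \<in> insert {} rectangles"
    proof cases
      case 2
      have AB: "A \<inter> B = {max x x'..min u u'} \<times> {max y y'..min v v'}" using 2 by auto
      show ?thesis
      proof (cases "A \<inter> B = {}")
        case False
        then have "max x x' \<le> min u u'" "max y y' \<le> min v v'" unfolding AB by auto
        then show ?thesis unfolding AB using 2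
          by (intro insertI2 rectanglesI) auto
      qed simp
    qed simp
  qed
  have "sigma_sets unit_square rectangles = sigma_sets unit_square (insert {} rectangles)"
    by (rule sigma_sets_eqI) (auto intro: sigma_sets.Basic sigma_sets.Empty)
  then show "sets M = sigma_sets unit_square (insert {} rectangles)"
    "sets N = sigma_sets unit_square (insert {} rectangles)"
    unfolding M N sets_square_borel by simp_all
  show "emeasure M X = emeasure N X" if "X \<in> insert {} rectangles" for X
    using that eq by (auto simp: rectangles_def)
  show "range (\<lambda>_. unit_square) \<subseteq> insert {} rectangles"
  proof -
    have "unit_square \<in> rectangles"
      by (intro rectanglesI) auto
    then show ?thesis by auto
  qed
qed (use rectangles_subset fin in auto)

text \<open>
  Closed rectangles share edges, so inclusion and exclusion only works up to the lines \<open>{x} \<times> {0..1}\<close> and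
  \<open>{0..1} \<times> {y}\<close>. These are null because the margins of a copula are uniform.
\<close>

lemma measure_rectangle_if_cdf:
  assumes C: "is_copula C" and "finite_measure N" and N: "sets N = sets square_borel"
    and cdf: "\<And>x y. x \<in> {0..1} \<Longrightarrow> y \<in> {0..1} \<Longrightarrow> measure N ({0..x} \<times> {0..y}) = C x y"
    and r: "0 \<le> x" "x \<le> u" "u \<le> 1" "0 \<le> y" "y \<le> v" "v \<le> 1"
  shows "measure N ({x..u} \<times> {y..v}) = C u v - C u y - C x v + C x y"
proof -
  interpret finite_measure N by fact
  have S: "{x..u} \<times> {y..v} \<in> sets N" if "0 \<le> x" "u \<le> 1" "0 \<le> y" "v \<le> 1" for x u y v
    using rectangle_in_sets[OF that] N by simp
  have vert: "{x} \<times> {0..1} \<in> null_sets N" if x: "x \<in> {0..1}" for x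
  proof -
    have "measure N ({x..x} \<times> {0..1}) \<le> 0 + e" if "0 < e" for e
    proof (cases "x = 0")
      case True
      then show ?thesis using cdf[of 0 1] copula_margins[OF C, of 1] \<open>0 < e\<close> by simp
    next
      case False
      define x' where "x' = max 0 (x - e)"
      have x': "x' \<in> {0..1}" "x' < x" "x - x' \<le> e" using x False \<open>0 < e\<close> by (auto simp: x'_def)
      have "measure N ({x..x} \<times> {0..1}) \<le> measure N ({0..x} \<times> {0..1} - {0..x'} \<times> {0..1})"
        using x x' by (intro finite_measure_mono sets.Diff S) auto
      also have "\<dots> = measure N ({0..x} \<times> {0..1}) - measure N ({0..x'} \<times> {0..1})"
        using x x' by (intro finite_measure_Diff S) auto
      also have "\<dots> = x - x'" using cdf x x' copula_margins[OF C] by simp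
      finally show ?thesis using x' by simp
    qed
    then have "measure N ({x} \<times> {0..1}) \<le> 0" using field_le_epsilon[of "measure N ({x..x} \<times> {0..1})" 0] by simp
    then have "measure N ({x} \<times> {0..1}) = 0" by (simp add: measure_le_0_iff)
    then show ?thesis using S[of x x 0 1] x by (intro null_setsI) (auto simp: emeasure_eq_measure)
  qed
  have hori: "{0..1} \<times> {y} \<in> null_sets N" if y: "y \<in> {0..1}" for y
  proof -
    have "measure N ({0..1} \<times> {y..y}) \<le> 0 + e" if "0 < e" for e
    proof (cases "y = 0")
      case True
      then show ?thesis using cdf[of 1 0] copula_margins[OF C, of 1] \<open>0 < e\<close> by simp
    next
      case False
      define y' where "y' = max 0 (y - e)"
      have y': "y' \<in> {0..1}" "y' < y" "y - y' \<le> e" using y False \<open>0 < e\<close> by (auto simp: y'_def)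
      have "measure N ({0..1} \<times> {y..y}) \<le> measure N ({0..1} \<times> {0..y} - {0..1} \<times> {0..y'})"
        using y y' by (intro finite_measure_mono sets.Diff S) auto
      also have "\<dots> = measure N ({0..1} \<times> {0..y}) - measure N ({0..1} \<times> {0..y'})"
        using y y' by (intro finite_measure_Diff S) auto
      also have "\<dots> = y - y'" using cdf y y' copula_margins[OF C] by simp
      finally show ?thesis using y' by simp
    qed
    then have "measure N ({0..1} \<times> {y}) \<le> 0" using field_le_epsilon[of "measure N ({0..1} \<times> {y..y})" 0] by simp
    then have "measure N ({0..1} \<times> {y}) = 0" by (simp add: measure_le_0_iff)
    then show ?thesis using S[of 0 1 y y] y by (intro null_setsI) (auto simp: emeasure_eq_measure)
  qed
  let ?Q = "\<lambda>a b. {0..a} \<times> {0..b}"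
  have Q: "?Q a b \<in> sets N" if "a \<le> 1" "b \<le> 1" for a b using S[of 0 a 0 b] that by simp
  have "AE p in N. p \<notin> {x} \<times> {0..1}" "AE p in N. p \<notin> {0..1} \<times> {y}"
    using vert[of x] hori[of y] r by (auto intro: AE_not_in)
  then have "AE p in N. p \<in> {x..u} \<times> {y..v} \<longleftrightarrow> p \<in> ?Q u v - (?Q x v \<union> ?Q u y)"
    by eventually_elim (use r in auto)
  then have "measure N ({x..u} \<times> {y..v}) = measure N (?Q u v - (?Q x v \<union> ?Q u y))"
    using r by (intro finite_measure_eq_AE sets.Diff sets.Un Q S) auto
  also have "\<dots> = measure N (?Q u v) - measure N (?Q x v \<union> ?Q u y)"
    using r by (intro finite_measure_Diff sets.Un Q) auto
  also have "measure N (?Q x v \<union> ?Q u y) = measure N (?Q x v) + measure N (?Q u y) - measure N (?Q x v \<inter> ?Q u y)"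
    using r by (intro measure_Un3; unfold fmeasurable_eq_sets; intro Q) auto
  also have "?Q x v \<inter> ?Q u y = ?Q x y" using r by auto
  finally show ?thesis using cdf r by simp
qed

text \<open>
  The measure \<open>N\<close> itself witnesses that the volumes of rectangles extend to a measure, so
  \<^const>\<open>copula_measure\<close> is such an extension, and a measure is determined by its values on rectangles.
\<close>

lemma copula_measure_eqI:
  assumes C: "is_copula C" and fin: "finite_measure N" and N: "sets N = sets square_borel"
    and cdf: "\<And>x y. x \<in> {0..1} \<Longrightarrow> y \<in> {0..1} \<Longrightarrow> measure N ({0..x} \<times> {0..y}) = C x y"
  shows "copula_measure C = N"
proof (rule measure_eqI_rectangles[symmetric])
  interpret finite_measure N by (rule fin)
  have rect: "measure N ({x..u} \<times> {y..v}) = C u v - C u y - C x v + C x y"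
    if "0 \<le> x" "x \<le> u" "u \<le> 1" "0 \<le> y" "y \<le> v" "v \<le> 1" for x u y v
    using measure_rectangle_if_cdf[OF C fin N _ that] cdf by blast
  show "sets (copula_measure C) = sets square_borel" by (rule sets_copula_measure)
  show "emeasure N unit_square \<noteq> \<infinity>" by simp
  fix x u y v :: real assume r: "0 \<le> x" "x \<le> u" "u \<le> 1" "0 \<le> y" "y \<le> v" "v \<le> 1"
  let ?I = "{(x::real, u, y::real, v). 0 \<le> x \<and> x \<le> u \<and> u \<le> 1 \<and> 0 \<le> y \<and> y \<le> v \<and> v \<le> 1}"
  let ?G = "\<lambda>(x::real, u, y::real, v). {x..u} \<times> {y..v}"
  have "emeasure (copula_measure C) (?G (x, u, y, v)) =
      (case (x, u, y, v) of (x, u, y, v) \<Rightarrow> ennreal (C u v - C u y - C x v + C x y))"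
  proof (rule emeasure_extend_measure[OF copula_measure_def, where \<mu>' = "emeasure N"])
    show "emeasure N (?G i) = (case i of (x, u, y, v) \<Rightarrow> ennreal (C u v - C u y - C x v + C x y))"
      if "i \<in> ?I" for i
      using that by (auto simp: emeasure_eq_measure rect)
    show "?G ` ?I \<subseteq> Pow unit_square" by auto
    show "positive (sets (copula_measure C)) (emeasure N)"
      unfolding sets_copula_measure N[symmetric] by (rule emeasure_positive)
    show "countably_additive (sets (copula_measure C)) (emeasure N)"
      unfolding sets_copula_measure N[symmetric] by (rule emeasure_countably_additive)
    show "(x, u, y, v) \<in> ?I" using r by simp
  qed
  then show "emeasure N ({x..u} \<times> {y..v}) = emeasure (copula_measure C) ({x..u} \<times> {y..v})"
    using rect[OF r] by (simp add: emeasure_eq_measure)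
qed (rule N)

text \<open>
  If the volumes of rectangles did not extend to a measure, \<^const>\<open>copula_measure\<close> would be the zero
  measure by convention.
\<close>

lemma emeasure_copula_measure_rectangle:
  assumes nz: "emeasure (copula_measure C) A \<noteq> 0"
    and r: "0 \<le> x" "x \<le> u" "u \<le> 1" "0 \<le> y" "y \<le> v" "v \<le> 1"
  shows "emeasure (copula_measure C) ({x..u} \<times> {y..v}) = ennreal (C u v - C u y - C x v + C x y)"
proof -
  let ?I = "{(x::real, u, y::real, v). 0 \<le> x \<and> x \<le> u \<and> u \<le> 1 \<and> 0 \<le> y \<and> y \<le> v \<and> v \<le> 1}"
  let ?G = "\<lambda>(x::real, u, y::real, v). {x..u} \<times> {y..v}"
  let ?m = "\<lambda>(x, u, y, v). ennreal (C u v - C u y - C x v + C x y)"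
  have sub: "?G ` ?I \<subseteq> Pow unit_square" by auto
  have sets: "sets (copula_measure C) = sigma_sets unit_square (?G ` ?I)"
    unfolding copula_measure_def using sub by (rule sets_extend_measure)
  have "\<exists>\<mu>'. (\<forall>i\<in>?I. \<mu>' (?G i) = ?m i) \<and> measure_space unit_square (sigma_sets unit_square (?G ` ?I)) \<mu>'"
  proof (rule ccontr)
    assume "\<not> ?thesis"
    then have "copula_measure C = sigma unit_square (?G ` ?I)"
      unfolding copula_measure_def extend_measure_def by (simp only: simp_thms if_False)
    then show False using nz by (simp add: emeasure_sigma)
  qed
  then obtain \<mu>' where \<mu>': "\<forall>i\<in>?I. \<mu>' (?G i) = ?m i"
    "measure_space unit_square (sigma_sets unit_square (?G ` ?I)) \<mu>'" by blast
  have "emeasure (copula_measure C) (?G (x, u, y, v)) = ?m (x, u, y, v)"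
  proof (rule emeasure_extend_measure[OF copula_measure_def, where \<mu>' = \<mu>'])
    show "positive (sets (copula_measure C)) \<mu>'" "countably_additive (sets (copula_measure C)) \<mu>'"
      using \<mu>'(2) unfolding sets measure_space_def by auto
    show "(x, u, y, v) \<in> ?I" using r by simp
  qed (use \<mu>'(1) sub in blast)+
  then show ?thesis by simp
qed

lemma measurable_fst_square: "fst \<in> square_borel \<rightarrow>\<^sub>M unif"
  and measurable_snd_square: "snd \<in> square_borel \<rightarrow>\<^sub>M unif"
proof -
  have "fst \<in> borel_measurable square_borel" "snd \<in> borel_measurable square_borel"
    by (intro measurable_restrict_space1 borel_measurable_continuous_onI continuous_intros)+
  then show "fst \<in> square_borel \<rightarrow>\<^sub>M unif" "snd \<in> square_borel \<rightarrow>\<^sub>M unif"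
    by (auto intro!: measurable_restrict_space2 simp: space_square_borel)
qed

lemma measurable_pair_square:
  assumes "a \<in> unif \<rightarrow>\<^sub>M unif" "b \<in> unif \<rightarrow>\<^sub>M unif"
  shows "(\<lambda>t. (a t, b t)) \<in> unif \<rightarrow>\<^sub>M square_borel"
proof (rule measurable_restrict_space2)
  have m: "f \<in> borel_measurable unif" if "f \<in> unif \<rightarrow>\<^sub>M unif" for f
    using that measurable_restrict_space2_iff[of f unif lborel "{0..1}"] by simp
  show "(\<lambda>t. (a t, b t)) \<in> unif \<rightarrow>\<^sub>M borel"
    using assms by (intro borel_measurable_Pair m)
  show "(\<lambda>t. (a t, b t)) \<in> space unif \<rightarrow> unit_square"
    using measurable_space[OF assms(1)] measurable_space[OF assms(2)] by (auto simp: Pi_iff)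
qed

lemma copula_measure_eq_distr:
  assumes C: "is_copula C" and a: "a \<in> unif \<rightarrow>\<^sub>M unif" and b: "b \<in> unif \<rightarrow>\<^sub>M unif"
    and cdf: "\<And>x y. x \<in> {0..1} \<Longrightarrow> y \<in> {0..1} \<Longrightarrow> C x y = measure unif {t\<in>{0..1}. a t \<le> x \<and> b t \<le> y}"
  shows "copula_measure C = distr unif square_borel (\<lambda>t. (a t, b t))"
proof (rule copula_measure_eqI[OF C])
  note m = measurable_pair_square[OF a b]
  show "finite_measure (distr unif square_borel (\<lambda>t. (a t, b t)))"
    by (rule unif.finite_measure_distr[OF m])
  fix x y :: real assume xy: "x \<in> {0..1}" "y \<in> {0..1}"
  have "a t \<in> {0..1}" "b t \<in> {0..1}" if "t \<in> {0..1}" for t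
    using measurable_space[OF a] measurable_space[OF b] that by auto
  then have "(\<lambda>t. (a t, b t)) -` ({0..x} \<times> {0..y}) \<inter> space unif = {t\<in>{0..1}. a t \<le> x \<and> b t \<le> y}"
    by fastforce
  then show "measure (distr unif square_borel (\<lambda>t. (a t, b t))) ({0..x} \<times> {0..y}) = C x y"
    using xy cdf by (subst measure_distr[OF m]) (auto intro: rectangle_in_sets)
qed simp

lemma copula_measure_if_carried_by_graph:
  assumes C: "is_copula C" and g: "carried_by_graph C g"
  shows "copula_measure C = distr unif square_borel (\<lambda>s. (s, g s))"
  using g unfolding carried_by_graph_def by (intro copula_measure_eq_distr[OF C]) auto

lemma copula_measure_if_transposed_carried_by_graph:
  assumes C: "is_copula C" and h: "carried_by_graph (transposed C) h"
  shows "copula_measure C = distr unif square_borel (\<lambda>t. (h t, t))"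
  using h unfolding carried_by_graph_def
  by (intro copula_measure_eq_distr[OF C]) (auto simp: conj_commute)

lemma is_copula_min: "is_copula min"
  unfolding is_copula_def by (auto simp: min_def)

lemma copula_measure_min: "copula_measure min = distr unif square_borel (\<lambda>t. (t, t))"
proof (rule copula_measure_eq_distr[OF is_copula_min])
  fix x y :: real assume "x \<in> {0..1}" "y \<in> {0..1}"
  then have "{t\<in>{0..1}. t \<le> x \<and> t \<le> y} = {0..min x y}" "min x y \<in> {0..1}" by auto
  then show "min x y = measure unif {t\<in>{0..1}. t \<le> x \<and> t \<le> y}" by (simp add: measure_unif)
qed auto

text \<open>
  The two preimages of a measurable set differ by subsets of a null set.
\<close>

lemma measurable_completion_AE_cong:
  assumes g: "g \<in> M \<rightarrow>\<^sub>M N" and f: "f \<in> space M \<rightarrow> space N" and eq: "AE x in M. f x = g x"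
  shows "f \<in> completion M \<rightarrow>\<^sub>M N"
proof (rule measurableI)
  fix A assume A: "A \<in> sets N"
  have *: "Measurable.pred (completion M) (\<lambda>x. f x \<in> A \<and> g x \<notin> A)"
    "Measurable.pred (completion M) (\<lambda>x. g x \<in> A \<and> f x \<notin> A)"
    by (rule sets_completion_AE, use eq in \<open>eventually_elim; auto\<close>)+
  have "g -` A \<inter> space (completion M) \<in> sets (completion M)"
    by (rule measurable_sets[OF measurable_completion[OF g] A])
  then have "(g -` A \<inter> space (completion M) - {x \<in> space (completion M). g x \<in> A \<and> f x \<notin> A})
      \<union> {x \<in> space (completion M). f x \<in> A \<and> g x \<notin> A} \<in> sets (completion M)"
    using * unfolding pred_def by (intro sets.Un sets.Diff)
  moreover have "(g -` A \<inter> space (completion M) - {x \<in> space (completion M). g x \<in> A \<and> f x \<notin> A})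
      \<union> {x \<in> space (completion M). f x \<in> A \<and> g x \<notin> A} = f -` A \<inter> space (completion M)" by auto
  ultimately show "f -` A \<inter> space (completion M) \<in> sets (completion M)" by simp
qed (use f in auto)

text \<open>
  The measure of Min is the law of \<open>(t, t)\<close>, so its first margin is Lebesgue measure: a null set of
  exceptional \<open>t\<close> gives a null set of exceptional points of the square, and the Lebesgue measurable
  \<open>T\<close> can be replaced by its Borel version \<open>a\<close>.
\<close>

lemma push_S_copula_measure_min:
  assumes T: "T \<in> {0..1} \<rightarrow> {0..1}" and a: "a \<in> unif \<rightarrow>\<^sub>M unif" and eq: "AE t in unif. T t = a t"
  shows "push_S T (copula_measure min) = distr unif square_borel (\<lambda>t. (a t, t))"
proof -
  let ?\<mu> = "copula_measure min"
  have diag: "(\<lambda>t. (t, t)) \<in> unif \<rightarrow>\<^sub>M square_borel"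
    by (rule measurable_pair_square) auto
  note fst = measurable_fst_square
  have S: "S_map a \<in> square_borel \<rightarrow>\<^sub>M square_borel"
  proof (rule measurable_restrict_space2)
    have a': "a \<in> borel_measurable unif"
      using a measurable_restrict_space2_iff[of a unif lborel "{0..1}"] by simp
    have "(\<lambda>p. a (fst p)) \<in> borel_measurable square_borel"
      by (rule measurable_compose[OF fst a'])
    moreover have "snd \<in> borel_measurable square_borel"
      by (intro measurable_restrict_space1 borel_measurable_continuous_onI continuous_intros)
    ultimately show "S_map a \<in> borel_measurable square_borel"
      unfolding S_map_def case_prod_beta' by (rule borel_measurable_Pair)
    show "S_map a \<in> space square_borel \<rightarrow> unit_square"
      using measurable_space[OF a] by (auto simp: S_map_def space_square_borel Pi_iff)
  qed
  have S\<mu>: "S_map a \<in> ?\<mu> \<rightarrow>\<^sub>M square_borel"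
    using S measurable_cong_sets[OF sets_copula_measure refl] by blast
  obtain Z where Z: "Z \<in> null_sets unif" "{t\<in>space unif. T t \<noteq> a t} \<subseteq> Z"
    using eq by (auto elim: AE_E3 simp: eventually_ae_filter)
  have AE: "AE p in ?\<mu>. S_map T p = S_map a p"
  proof (rule AE_I')
    have "fst -` Z \<inter> space square_borel \<in> sets square_borel"
      by (rule measurable_sets[OF fst null_setsD2[OF Z(1)]])
    moreover have "emeasure ?\<mu> (fst -` Z \<inter> space square_borel) = 0"
      unfolding copula_measure_min
    proof (subst emeasure_distr[OF diag])
      have "(\<lambda>t. (t, t)) -` (fst -` Z \<inter> space square_borel) \<inter> space unif = Z"
        using sets.sets_into_space[OF null_setsD2[OF Z(1)]] by (auto simp: space_square_borel)
      then show "emeasure unif ((\<lambda>t. (t, t)) -` (fst -` Z \<inter> space square_borel) \<inter> space unif) = 0"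
        using Z(1) by auto
    qed fact
    ultimately show "fst -` Z \<inter> space square_borel \<in> null_sets ?\<mu>"
      by (auto intro!: null_setsI simp: sets_copula_measure)
    have "space ?\<mu> = space square_borel" using sets_copula_measure by (rule sets_eq_imp_space_eq)
    then show "{p \<in> space ?\<mu>. S_map T p \<noteq> S_map a p} \<subseteq> fst -` Z \<inter> space square_borel"
      using Z(2) by (auto simp: S_map_def space_square_borel)
  qed
  have "S_map T \<in> completion ?\<mu> \<rightarrow>\<^sub>M square_borel"
  proof (rule measurable_completion_AE_cong[OF S\<mu> _ AE])
    have "space ?\<mu> = space square_borel" using sets_copula_measure by (rule sets_eq_imp_space_eq)
    then show "S_map T \<in> space ?\<mu> \<rightarrow> space square_borel"
      using T by (auto simp: S_map_def space_square_borel Pi_iff)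
  qed
  then have "push_S T ?\<mu> = distr (completion ?\<mu>) square_borel (S_map a)"
    unfolding push_S_def using AE_completion[OF AE] measurable_completion[OF S\<mu>]
    by (intro distr_cong_AE) auto
  also have "\<dots> = distr ?\<mu> square_borel (S_map a)"
    by (rule distr_completion[OF S\<mu>])
  also have "\<dots> = distr unif square_borel (S_map a \<circ> (\<lambda>t. (t, t)))"
    unfolding copula_measure_min by (rule distr_distr[OF S diag])
  finally show ?thesis by (simp add: S_map_def comp_def)
qed


section \<open>Shuffles of Min have mass on a graph over either axis\<close>

lemma sets_lebesgue_on_01: "A \<in> sets (lebesgue_on {0..1}) \<longleftrightarrow> A \<subseteq> {0..1} \<and> A \<in> sets lebesgue" for A :: "real set"
  by (subst sets_restrict_space_iff) auto

lemma emeasure_lebesgue_on_01: "A \<subseteq> {0..1} \<Longrightarrow> emeasure (lebesgue_on {0..1}) A = emeasure lebesgue A" for A :: "real set"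
  by (intro emeasure_restrict_space) auto

lemma lebesgue_on_01_borel_version:
  assumes f: "f \<in> borel_measurable (lebesgue_on {0..1})" and range: "f \<in> {0..1} \<rightarrow> {0..1::real}"
  obtains a where "a \<in> borel_measurable borel" "\<And>t. a t \<in> {0..1}" "AE t in unif. f t = a t"
proof -
  have "(\<lambda>x. if x \<in> {0..1} then f x else 0) \<in> borel_measurable (completion lborel)"
    using f by (subst borel_measurable_if) auto
  then obtain g where g: "g \<in> borel_measurable lborel"
    "AE x in lborel. (if x \<in> {0..1} then f x else 0) = g x"
    using completion_ex_borel_measurable_real by blast
  show thesis
  proof
    have "clamp01 \<in> borel_measurable borel"
      by (intro borel_measurable_continuous_onI nonexpansive_mono_continuous nonexpansive_mono_clamp01)
    then show "(\<lambda>t. clamp01 (g t)) \<in> borel_measurable borel"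
      using g(1) by (intro measurable_compose[of g borel borel clamp01]) auto
    show "clamp01 (g t) \<in> {0..1}" for t by (rule clamp01_range)
    show "AE t in unif. f t = clamp01 (g t)"
      unfolding AE_unif_iff using g(2)
    proof eventually_elim
      case (elim t)
      show ?case
      proof
        assume "t \<in> {0..1}"
        then have "f t \<in> {0..1}" "g t = f t" using range elim \<open>t \<in> {0..1}\<close> by (blast, simp)
        then show "f t = clamp01 (g t)" using clamp01_id[of "f t"] by simp
      qed
    qed
  qed
qed

lemma measurable_unif_if_borel:
  assumes "a \<in> borel_measurable borel" "\<And>t. a t \<in> {0..1}"
  shows "a \<in> unif \<rightarrow>\<^sub>M unif"
proof (rule measurable_restrict_space2)
  show "a \<in> unif \<rightarrow>\<^sub>M lborel" using measurable_unif_borel[OF assms(1)] by simp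
qed (use assms in blast)

lemma measure_preserving_01_measurable:
  assumes "measure_preserving_01 T"
  shows "T \<in> borel_measurable (lebesgue_on {0..1})" "T \<in> {0..1} \<rightarrow> {0..1}"
proof -
  have T: "T \<in> lebesgue_on {0..1} \<rightarrow>\<^sub>M lebesgue_on {0..1}"
    using assms by (simp add: measure_preserving_01_def)
  then show "T \<in> {0..1} \<rightarrow> {0..1}" using measurable_space[OF T] by auto
  have "T \<in> lebesgue_on {0..1} \<rightarrow>\<^sub>M lebesgue" using T measurable_restrict_space2_iff[of T _ lebesgue "{0..1}"] by simp
  moreover have "(\<lambda>x::real. x) \<in> lebesgue \<rightarrow>\<^sub>M borel" by (intro measurable_completion) simp
  ultimately show "T \<in> borel_measurable (lebesgue_on {0..1})"
    by (rule measurable_compose)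
qed

text \<open>
  The graph of \<open>T\<close> over \<open>S\<close> is, up to a null set, a Borel subset of the plane, and it carries mass
  \<open>m(S)\<close> under the law of \<open>(T t, t)\<close>. By inner regularity a compact part of the graph carries almost as
  much; its projection to the first axis is a compact subset of \<open>T(S)\<close>, with at least the same measure
  because \<open>T\<close> preserves measure.
\<close>

lemma compact_approximation_of_image:
  assumes T: "measure_preserving_01 T" and S: "S \<in> sets borel" "S \<subseteq> {0..1}" and e: "0 < e"
  shows "\<exists>K. compact K \<and> K \<subseteq> T ` S \<and> measure lborel S \<le> measure lborel K + e"
proof (cases "measure lborel S \<le> e")
  case True
  then show ?thesis by (intro exI[of _ "{}"]) auto
next
  case False
  obtain a where a: "a \<in> borel_measurable borel" "\<And>t. a t \<in> {0..1}" "AE t in unif. T t = a t"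
    using lebesgue_on_01_borel_version[OF measure_preserving_01_measurable[OF T]] by blast
  obtain Z where Z: "Z \<in> null_sets unif" "{t\<in>space unif. T t \<noteq> a t} \<subseteq> Z"
    using a(3) by (auto simp: eventually_ae_filter)
  have Zb: "Z \<in> sets borel" using null_setsD2[OF Z(1)] by (simp add: sets_unif)
  have pm: "(\<lambda>t. (a t, t)) \<in> borel_measurable unif"
    using a(1) by (intro measurable_unif_borel borel_measurable_Pair) auto
  define \<mu> where "\<mu> = distr unif borel (\<lambda>t. (a t, t))"
  \<comment> \<open>Only the part of the graph on which \<open>T\<close> agrees with its Borel version \<open>a\<close>.\<close>
  define G where "G = {p. snd p \<in> S - Z \<and> fst p = a (snd p)}"
  have "{p::real \<times> real. snd p \<in> S - Z} \<in> sets borel"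
  proof -
    have "snd -` (S - Z) \<inter> space (borel :: (real \<times> real) measure) \<in> sets borel"
      using S(1) Zb by (intro measurable_sets[of _ _ borel] borel_measurable_continuous_onI continuous_intros) auto
    then show ?thesis by (simp add: vimage_def)
  qed
  moreover have "{p::real \<times> real. fst p = a (snd p)} \<in> sets borel"
  proof -
    have "(\<lambda>p::real \<times> real. fst p - a (snd p)) \<in> borel_measurable borel"
      by (intro borel_measurable_diff measurable_compose[OF _ a(1)] borel_measurable_continuous_onI continuous_intros)
    then have "(\<lambda>p::real \<times> real. fst p - a (snd p)) -` {0} \<inter> space borel \<in> sets borel"
      by (rule measurable_sets) simp
    then show ?thesis by (simp add: vimage_def)
  qed
  ultimately have G: "G \<in> sets borel"
    unfolding G_def Collect_conj_eq by (rule sets.Int)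
  have "emeasure \<mu> G = emeasure unif (S - Z)"
    unfolding \<mu>_def
    by (subst emeasure_distr[OF pm G]) (use S in \<open>auto simp: G_def intro!: arg_cong[of _ _ "emeasure unif"]\<close>)
  also have "\<dots> = emeasure unif S"
    using Z(1) S by (intro emeasure_Diff_null_set) (auto simp: sets_unif)
  also have "\<dots> = ennreal (measure lborel S)"
  proof -
    have "emeasure lborel S \<le> emeasure lborel {0..1::real}" using S by (intro emeasure_mono) auto
    then have "emeasure lborel S \<noteq> \<infinity>" by (auto simp: top_unique)
    then show ?thesis using S by (simp add: measure_unif emeasure_unif emeasure_eq_ennreal_measure)
  qed
  finally have \<mu>G: "emeasure \<mu> G = ennreal (measure lborel S)" .
  have "emeasure \<mu> (space \<mu>) \<noteq> \<infinity>"
    unfolding \<mu>_def using finite_measure.emeasure_finite[OF unif.finite_measure_distr[OF pm]] by simp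
  then have "emeasure \<mu> G = (SUP K\<in>{K. K \<subseteq> G \<and> compact K}. emeasure \<mu> K)"
    using G by (intro inner_regular) (auto simp: \<mu>_def)
  moreover have "ennreal (measure lborel S - e) < emeasure \<mu> G"
    unfolding \<mu>G using e False by (intro ennreal_lessI) auto
  ultimately obtain K where K: "K \<subseteq> G" "compact K" "ennreal (measure lborel S - e) < emeasure \<mu> K"
    by (auto simp: less_SUP_iff)
  define F where "F = fst ` K"
  have cK: "compact F" unfolding F_def using K(2) by (intro compact_continuous_image continuous_intros)
  have sub: "F \<subseteq> T ` S"
  proof
    fix s assume "s \<in> F"
    then obtain t where t: "t \<in> S" "t \<notin> Z" "s = a t" using K(1) by (auto simp: G_def F_def)
    then have "t \<in> space unif" using S(2) by auto
    then have "T t = a t" using Z(2) t(2) by blast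
    then show "s \<in> T ` S" using t by (metis imageI)
  qed
  have sub01: "F \<subseteq> {0..1}" using K(1) a(2) by (auto simp: G_def F_def)
  have meas: "{t\<in>{0..1}. a t \<in> F} \<in> sets borel"
  proof -
    have "a -` F \<inter> space borel \<in> sets borel"
      using cK by (intro measurable_sets[OF a(1)] borel_compact)
    then have "{0..1} \<inter> (a -` F \<inter> space borel) \<in> sets borel" by (intro sets.Int) auto
    then show ?thesis by (rule back_subst[of "\<lambda>A. A \<in> sets borel"]) auto
  qed
  have "emeasure \<mu> K = emeasure unif ((\<lambda>t. (a t, t)) -` K \<inter> space unif)"
    unfolding \<mu>_def using K(2) by (intro emeasure_distr[OF pm] borel_compact)
  also have "\<dots> \<le> emeasure unif {t\<in>{0..1}. a t \<in> F}"
    using meas by (intro emeasure_mono) (auto simp: sets_unif F_def intro: rev_image_eqI)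
  also have "\<dots> = emeasure lebesgue {t\<in>{0..1}. a t \<in> F}"
    using meas by (subst emeasure_unif) auto
  also have "\<dots> = emeasure lebesgue (T -` F \<inter> {0..1})"
  proof (rule emeasure_eq_AE)
    have "AE t in lborel. t \<in> {0..1} \<longrightarrow> T t = a t" using a(3) by (simp only: AE_unif_iff)
    then have "AE t in lebesgue. t \<in> {0..1} \<longrightarrow> T t = a t" by (rule AE_completion)
    then show "AE t in lebesgue. t \<in> {t\<in>{0..1}. a t \<in> F} \<longleftrightarrow> t \<in> T -` F \<inter> {0..1}"
      by eventually_elim auto
    show "{t\<in>{0..1}. a t \<in> F} \<in> sets lebesgue" using meas by auto
    have "T \<in> lebesgue_on {0..1} \<rightarrow>\<^sub>M lebesgue_on {0..1}" using T by (simp add: measure_preserving_01_def)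
    moreover have "F \<in> sets (lebesgue_on {0..1})"
      using sub01 borel_compact[OF cK] by (auto simp: sets_lebesgue_on_01)
    ultimately have "T -` F \<inter> space (lebesgue_on {0..1}) \<in> sets (lebesgue_on {0..1})"
      by (rule measurable_sets)
    then show "T -` F \<inter> {0..1} \<in> sets lebesgue" by (simp add: sets_lebesgue_on_01)
  qed
  also have "\<dots> = emeasure (lebesgue_on {0..1}) (T -` F \<inter> {0..1})"
    by (simp add: emeasure_lebesgue_on_01)
  also have "\<dots> = emeasure (lebesgue_on {0..1}) F"
    using T sub01 borel_compact[OF cK] unfolding measure_preserving_01_def
    by (auto simp: sets_lebesgue_on_01)
  also have "\<dots> = emeasure lborel F"
    using sub01 borel_compact[OF cK] by (simp add: emeasure_lebesgue_on_01)
  also have "\<dots> = ennreal (measure lborel F)"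
    using emeasure_compact_finite[OF cK] by (simp add: emeasure_eq_ennreal_measure)
  finally have "ennreal (measure lborel S - e) < ennreal (measure lborel F)"
    using K(3) by simp
  then have "measure lborel S - e \<le> measure lborel F"
    using False by (simp add: ennreal_less_iff)
  then show ?thesis using cK sub by (intro exI[of _ "F"]) auto
qed

text \<open>
  The images of \<open>{0..v}\<close> and \<open>{v<..1}\<close> are disjoint because \<open>T\<close> is injective. Approximating both from
  inside by compact sets encloses the first one between sets of almost equal measure.
\<close>

lemma image_measurable:
  assumes T: "measure_preserving_01 T" and bij: "bij_betw T {0..1} {0..1}" and v: "v \<in> {0..1}"
  shows "T ` {0..v} \<in> sets lebesgue"
proof -
  have "T ` {0..v} \<in> lmeasurable"
    unfolding completion.fmeasurable_inner_outer
  proof (intro allI impI)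
    fix e :: real assume "0 < e"
    then have e3: "0 < e / 3" by simp
    have sub: "{0..v} \<subseteq> {0..1}" "{v<..1} \<subseteq> {0..1}" using v by auto
    obtain K where K: "compact K" "K \<subseteq> T ` {0..v}" "measure lborel {0..v} \<le> measure lborel K + e / 3"
      using compact_approximation_of_image[OF T _ _ e3, of "{0..v}"] v by auto
    obtain L where L: "compact L" "L \<subseteq> T ` {v<..1}" "measure lborel {v<..1} \<le> measure lborel L + e / 3"
      using compact_approximation_of_image[OF T _ sub(2) e3] by auto
    have inj: "inj_on T {0..1}" and im: "T ` {0..1} = {0..1}" using bij by (auto simp: bij_betw_def)
    have disj: "T ` {0..v} \<inter> T ` {v<..1} = {}"
      using inj v by (subst inj_on_image_Int[symmetric, OF inj]) auto
    have K01: "K \<subseteq> {0..1}" using order_trans[OF K(2) image_mono[OF sub(1), of T]] unfolding im .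
    have L01: "L \<subseteq> {0..1}" using order_trans[OF L(2) image_mono[OF sub(2), of T]] unfolding im .
    have KU: "T ` {0..v} \<subseteq> {0..1} - L"
    proof -
      have "T ` {0..v} \<subseteq> {0..1}" using image_mono[OF sub(1), of T] unfolding im .
      then show ?thesis using disj L(2) by blast
    qed
    have Km: "K \<in> lmeasurable" and Lm: "L \<in> lmeasurable" using K(1) L(1) by (auto intro: lmeasurable_compact)
    have Um: "{0..1} - L \<in> lmeasurable" using Lm by (intro fmeasurable.Diff) auto
    have mU: "measure lebesgue ({0..1} - L) = 1 - measure lebesgue L"
      using Lm L01 by (subst measurable_measure_Diff) auto
    have eqm: "measure lebesgue K = measure lborel K" "measure lebesgue L = measure lborel L"
      using borel_compact[OF K(1)] borel_compact[OF L(1)] by auto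
    have "measure lebesgue K \<le> measure lebesgue ({0..1} - L)"
      using K(2) KU Km Um by (intro measure_mono_fmeasurable fmeasurableD) auto
    moreover have "v \<le> measure lebesgue K + e / 3" "1 - v \<le> measure lebesgue L + e / 3"
      using K(3) L(3) v unfolding eqm by auto
    ultimately have "\<bar>measure lebesgue K - measure lebesgue ({0..1} - L)\<bar> < e"
      using mU \<open>0 < e\<close> by linarith
    then show "\<exists>K\<in>lmeasurable. \<exists>U\<in>lmeasurable. K \<subseteq> T ` {0..v} \<and> T ` {0..v} \<subseteq> U \<and>
        \<bar>measure lebesgue K - measure lebesgue U\<bar> < e"
      using Km Um K(2) KU by blast
  qed
  then show ?thesis by (rule fmeasurableD)
qed

lemma measurable_inverse:
  assumes T: "measure_preserving_01 T" and bij: "bij_betw T {0..1} {0..1}"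
  shows "inv_into {0..1} T \<in> borel_measurable (lebesgue_on {0..1})"
    and "inv_into {0..1} T \<in> {0..1} \<rightarrow> {0..1}"
proof -
  let ?R = "inv_into {0..1} T"
  have inj: "inj_on T {0..1}" and im: "T ` {0..1} = {0..1}" using bij by (auto simp: bij_betw_def)
  show R: "?R \<in> {0..1} \<rightarrow> {0..1}" using inv_into_into[of _ T "{0..1}"] im by auto
  show "?R \<in> borel_measurable (lebesgue_on {0..1})"
    unfolding borel_measurable_iff_le
  proof
    fix y :: real
    consider "y < 0" | "y \<in> {0..1}" | "1 < y" by fastforce
    then have "{s\<in>{0..1}. ?R s \<le> y} \<in> sets lebesgue"
    proof cases
      case 1
      have "\<not> ?R s \<le> y" if "s \<in> {0..1}" for s
        using funcset_mem[OF R that] 1 by simp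
      then have "{s\<in>{0..1}. ?R s \<le> y} = {}" by blast
      then show ?thesis by (simp only: sets.empty_sets)
    next
      case 2
      have "{s\<in>{0..1}. ?R s \<le> y} = T ` {0..y}"
      proof safe
        fix s assume s: "s \<in> {0..1}" "?R s \<le> y"
        then have "T (?R s) = s" using im by (intro f_inv_into_f) auto
        moreover have "?R s \<in> {0..y}" using s R by auto
        ultimately show "s \<in> T ` {0..y}" by (metis imageI)
      next
        fix t assume t: "t \<in> {0..y}"
        then have "t \<in> {0..1}" using 2 by auto
        then show "T t \<in> {0..1}" "?R (T t) \<le> y" using im t inv_into_f_f[OF inj] by auto
      qed
      then show ?thesis using image_measurable[OF T bij 2] by simp
    next
      case 3
      have "?R s \<le> y" if "s \<in> {0..1}" for s
        using funcset_mem[OF R that] 3 by simp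
      then have "{s\<in>{0..1}. ?R s \<le> y} = {0..1}" by blast
      moreover have "{0..1::real} \<in> sets lebesgue" by simp
      ultimately show ?thesis by (simp only:)
    qed
    then show "{s \<in> space (lebesgue_on {0..1}). ?R s \<le> y} \<in> sets (lebesgue_on {0..1})"
      by (simp add: sets_lebesgue_on_01) auto
  qed
qed

lemma emeasure_borel_version_sublevel:
  fixes f a :: "real \<Rightarrow> real"
  assumes f: "f \<in> borel_measurable (lebesgue_on {0..1})" and a: "a \<in> borel_measurable borel"
    and eq: "AE t in unif. f t = a t"
  shows "emeasure lebesgue {t\<in>{0..1}. t \<le> y \<and> f t \<le> x} = emeasure unif {t\<in>{0..1}. t \<le> y \<and> a t \<le> x}"
    and "{t\<in>{0..1}. t \<le> y \<and> f t \<le> x} \<in> sets lebesgue"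
proof -
  have "{t \<in> space borel. a t \<le> x} \<in> sets borel" using a unfolding borel_measurable_iff_le by blast
  then have "{t. a t \<le> x} \<in> sets borel" by simp
  then have "{0..1} \<inter> {..y} \<inter> {t. a t \<le> x} \<in> sets borel" by (intro sets.Int) auto
  also have "{0..1} \<inter> {..y} \<inter> {t. a t \<le> x} = {t\<in>{0..1}. t \<le> y \<and> a t \<le> x}" by auto
  finally have ab: "{t\<in>{0..1}. t \<le> y \<and> a t \<le> x} \<in> sets borel" .
  have "{t \<in> space (lebesgue_on {0..1}). f t \<le> x} \<in> sets (lebesgue_on {0..1})"
    using f unfolding borel_measurable_iff_le by blast
  then have "{t \<in> space (lebesgue_on {0..1}). f t \<le> x} \<in> sets lebesgue" unfolding sets_lebesgue_on_01 by blast
  then have "{..y} \<inter> {t \<in> space (lebesgue_on {0..1}). f t \<le> x} \<in> sets lebesgue" by (intro sets.Int) auto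
  also have "{..y} \<inter> {t \<in> space (lebesgue_on {0..1}). f t \<le> x} = {t\<in>{0..1}. t \<le> y \<and> f t \<le> x}" by auto
  finally show fb: "{t\<in>{0..1}. t \<le> y \<and> f t \<le> x} \<in> sets lebesgue" .
  have "AE t in lborel. t \<in> {0..1} \<longrightarrow> f t = a t" using eq by (simp only: AE_unif_iff)
  then have "AE t in lebesgue. t \<in> {0..1} \<longrightarrow> f t = a t" by (rule AE_completion)
  then have "AE t in lebesgue. t \<in> {t\<in>{0..1}. t \<le> y \<and> f t \<le> x} \<longleftrightarrow> t \<in> {t\<in>{0..1}. t \<le> y \<and> a t \<le> x}"
    by eventually_elim auto
  then have "emeasure lebesgue {t\<in>{0..1}. t \<le> y \<and> f t \<le> x} = emeasure lebesgue {t\<in>{0..1}. t \<le> y \<and> a t \<le> x}"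
    using fb ab by (intro emeasure_eq_AE) auto
  also have "\<dots> = emeasure lborel {t\<in>{0..1}. t \<le> y \<and> a t \<le> x}" using ab by simp
  also have "\<dots> = emeasure unif {t\<in>{0..1}. t \<le> y \<and> a t \<le> x}" by (subst emeasure_unif) auto
  finally show "emeasure lebesgue {t\<in>{0..1}. t \<le> y \<and> f t \<le> x} = emeasure unif {t\<in>{0..1}. t \<le> y \<and> a t \<le> x}" .
qed

text \<open>
  The law of \<open>(T t, t)\<close> is the law of \<open>(s, R s)\<close>, where \<open>R\<close> is the inverse of \<open>T\<close>, because \<open>T\<close>
  preserves measure. Both \<open>T\<close> and \<open>R\<close> are replaced by Borel versions.
\<close>

lemma carried_by_graphs_if_shuffle:
  assumes C: "is_copula C" and sh: "generalized_shuffle_of_Min C"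
  shows "\<exists>g. carried_by_graph C g" "\<exists>h. carried_by_graph (transposed C) h"
proof -
  obtain T where bij: "bij_betw T {0..1} {0..1}" and T: "measure_preserving_01 T"
    and CT: "copula_measure C = push_S T (copula_measure min)"
    using sh unfolding generalized_shuffle_of_Min_def by blast
  note Tm = measure_preserving_01_measurable[OF T]
  let ?R = "inv_into {0..1} T"
  obtain a where a: "a \<in> borel_measurable borel" "\<And>t. a t \<in> {0..1}" "AE t in unif. T t = a t"
    using lebesgue_on_01_borel_version[OF Tm] by blast
  obtain b where b: "b \<in> borel_measurable borel" "\<And>t. b t \<in> {0..1}" "AE t in unif. ?R t = b t"
    using lebesgue_on_01_borel_version[OF measurable_inverse[OF T bij]] by blast
  have au: "a \<in> unif \<rightarrow>\<^sub>M unif" and bu: "b \<in> unif \<rightarrow>\<^sub>M unif"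
    using a b by (auto intro!: measurable_unif_if_borel)
  have pm: "(\<lambda>t. (a t, t)) \<in> unif \<rightarrow>\<^sub>M square_borel"
    by (rule measurable_pair_square[OF au]) simp
  have CD: "copula_measure C = distr unif square_borel (\<lambda>t. (a t, t))"
    unfolding CT using Tm(2) au a(3) by (rule push_S_copula_measure_min)
  have em: "emeasure (copula_measure C) ({0..x} \<times> {0..y}) = emeasure unif {t\<in>{0..1}. t \<le> y \<and> a t \<le> x}"
    if "x \<in> {0..1}" "y \<in> {0..1}" for x y
  proof -
    have "(\<lambda>t. (a t, t)) -` ({0..x} \<times> {0..y}) \<inter> space unif = {t\<in>{0..1}. t \<le> y \<and> a t \<le> x}"
      using a(2) by auto
    then show ?thesis using that unfolding CD
      by (subst emeasure_distr[OF pm]) (auto intro: rectangle_in_sets)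
  qed
  have "emeasure (copula_measure C) ({0..1} \<times> {0..1}) = emeasure unif {0..1}"
  proof -
    have "{t\<in>{0..1}. t \<le> 1 \<and> a t \<le> 1} = {0..1}" using a(2) by auto
    then show ?thesis using em[of 1 1] by simp
  qed
  then have nz: "emeasure (copula_measure C) ({0..1} \<times> {0..1}) \<noteq> 0" by (simp add: emeasure_unif)
  have Cxy: "C x y = measure unif {t\<in>{0..1}. t \<le> y \<and> a t \<le> x}" if xy: "x \<in> {0..1}" "y \<in> {0..1}" for x y
  proof -
    have "ennreal (C x y - C x 0 - C 0 y + C 0 0) = emeasure unif {t\<in>{0..1}. t \<le> y \<and> a t \<le> x}"
      using emeasure_copula_measure_rectangle[OF nz, of 0 x 0 y] em[OF xy] xy by simp
    then have "ennreal (C x y) = ennreal (measure unif {t\<in>{0..1}. t \<le> y \<and> a t \<le> x})"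
      using copula_margins[OF C] xy by (simp add: unif.emeasure_eq_measure)
    moreover have "0 \<le> C x y" using copula_increment(1)[OF C, of 0 x y] copula_margins[OF C] xy by simp
    ultimately show ?thesis by simp
  qed
  then have "carried_by_graph (transposed C) a"
    unfolding carried_by_graph_def using au by auto
  then show "\<exists>h. carried_by_graph (transposed C) h" by blast
  have "C x y = measure unif {s\<in>{0..1}. s \<le> x \<and> b s \<le> y}" if xy: "x \<in> {0..1}" "y \<in> {0..1}" for x y
  proof -
    let ?B = "{s\<in>{0..1}. s \<le> x \<and> ?R s \<le> y}"
    have B: "?B \<in> sets (lebesgue_on {0..1})"
      using emeasure_borel_version_sublevel(2)[OF measurable_inverse(1)[OF T bij] b(1,3)]
      by (auto simp: sets_lebesgue_on_01)
    have inj: "inj_on T {0..1}" using bij by (auto simp: bij_betw_def)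
    have "T -` ?B \<inter> {0..1} = {t\<in>{0..1}. t \<le> y \<and> T t \<le> x}"
      using Tm(2) inv_into_f_f[OF inj] by auto
    moreover have "emeasure (lebesgue_on {0..1}) (T -` ?B \<inter> {0..1}) = emeasure (lebesgue_on {0..1}) ?B"
      using T B unfolding measure_preserving_01_def by blast
    ultimately have "emeasure (lebesgue_on {0..1}) {t\<in>{0..1}. t \<le> y \<and> T t \<le> x} = emeasure (lebesgue_on {0..1}) ?B"
      by simp
    moreover have "{t\<in>{0..1}. t \<le> y \<and> T t \<le> x} \<subseteq> {0..1}" "?B \<subseteq> {0..1}" by auto
    ultimately have "emeasure lebesgue {t\<in>{0..1}. t \<le> y \<and> T t \<le> x} = emeasure lebesgue ?B"
      by (simp only: emeasure_lebesgue_on_01)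
    then have "emeasure unif {t\<in>{0..1}. t \<le> y \<and> a t \<le> x} = emeasure unif {s\<in>{0..1}. s \<le> x \<and> b s \<le> y}"
      using emeasure_borel_version_sublevel(1)[OF Tm(1) a(1,3)]
        emeasure_borel_version_sublevel(1)[OF measurable_inverse(1)[OF T bij] b(1,3)] by simp
    then show ?thesis using Cxy[OF xy] by (simp add: measure_def)
  qed
  then have "carried_by_graph C b" unfolding carried_by_graph_def using bu by auto
  then show "\<exists>g. carried_by_graph C g" by blast
qed


section \<open>From two graphs to a measure-preserving bijection\<close>

text \<open>
  The function \<open>\<phi>\<close> jumps by \<open>4\<^sup>-\<^sup>n\<^sup>-\<^sup>1\<close> at the \<open>n\<close>-th rational. It is strictly increasing, because
  every nonempty open interval contains a rational. The first \<open>n\<close> jumps contribute one of at most \<open>2\<^sup>n\<close> values, and the remaining ones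
  less than \<open>4\<^sup>-\<^sup>n\<close>. So the range lies in \<open>2\<^sup>n\<close> intervals of length \<open>4\<^sup>-\<^sup>n\<close>, for every \<open>n\<close>.
\<close>

lemma null_set_continuum:
  obtains Z :: "real set" and \<phi> :: "real \<Rightarrow> real"
  where "Z \<in> null_sets lborel" "Z \<subseteq> {0..1}" "inj \<phi>" "range \<phi> \<subseteq> Z"
proof -
  define r where "r n = real_of_rat (nat_to_rat_surj n)" for n
  define f where "f x n = (if r n < x then (1 / 4) ^ Suc n else 0 :: real)" for x n
  define \<phi> where "\<phi> x = suminf (f x)" for x
  have nn: "0 \<le> f x n" and le: "f x n \<le> (1 / 4) ^ Suc n" for x n by (auto simp: f_def)
  have geo: "(\<lambda>n. (1 / 4) ^ Suc n :: real) sums (1 / 3)"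
    using sums_mult[OF geometric_sums[of "1 / 4 :: real"], of "1 / 4"] by simp
  have sm: "summable (f x)" for x
    by (rule summable_comparison_test'[OF sums_summable[OF geo], of 0]) (use nn le in auto)
  have strict: "\<phi> x < \<phi> y" if xy: "x < y" for x y
  proof -
    obtain q where q: "x < real_of_rat q" "real_of_rat q < y" using of_rat_dense[OF xy] by blast
    obtain n where "q = nat_to_rat_surj n" using surj_nat_to_rat_surj by (metis surjD)
    then have n: "x < r n" "r n < y" using q by (auto simp: r_def)
    have "0 < (\<Sum>n. f y n - f x n)"
    proof (rule suminf_pos2)
      show "summable (\<lambda>n. f y n - f x n)" by (intro summable_diff sm)
      show "0 \<le> f y n - f x n" for n using xy by (auto simp: f_def)
      show "0 < f y n - f x n" using n by (auto simp: f_def)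
    qed
    moreover have "\<phi> y - \<phi> x = (\<Sum>n. f y n - f x n)"
      unfolding \<phi>_def by (rule suminf_diff[OF sm sm])
    ultimately show ?thesis by simp
  qed
  have "inj \<phi>"
  proof (rule injI)
    fix x y assume "\<phi> x = \<phi> y"
    then show "x = y" using strict[of x y] strict[of y x] by (cases x y rule: linorder_cases) auto
  qed
  define W :: "nat \<Rightarrow> real set" where "W n = (\<Union>S\<in>Pow {..<n}. {(\<Sum>k\<in>S. (1 / 4) ^ Suc k)..(\<Sum>k\<in>S. (1 / 4) ^ Suc k) + (1 / 4) ^ n})"
    for n :: nat
  have W_sets: "W n \<in> sets lborel" for n unfolding W_def by (intro sets.finite_UN) auto
  have W_measure: "emeasure lborel (W n) \<le> ennreal ((1 / 2) ^ n)" for n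
  proof -
    have "emeasure lborel (W n) \<le> (\<Sum>S\<in>Pow {..<n}. emeasure lborel
        {(\<Sum>k\<in>S. (1 / 4) ^ Suc k)..(\<Sum>k\<in>S. (1 / 4) ^ Suc k) + (1 / 4 :: real) ^ n})"
      unfolding W_def by (intro emeasure_subadditive_finite) auto
    also have "\<dots> = (\<Sum>S\<in>Pow {..<n}. ennreal ((1 / 4) ^ n))"
      by (intro sum.cong refl) (subst emeasure_lborel_Icc; simp)
    also have "\<dots> = ennreal (2 ^ n * (1 / 4) ^ n)"
      by (simp add: card_Pow ennreal_mult ennreal_power[symmetric])
    also have "2 ^ n * (1 / 4) ^ n = ((1 / 2) ^ n :: real)"
      by (simp flip: power_mult_distrib)
    finally show ?thesis .
  qed
  have in_W: "\<phi> x \<in> W n" for x n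
  proof -
    let ?S = "{k. k < n \<and> r k < x}"
    have "\<phi> x = (\<Sum>k. f x (k + n)) + (\<Sum>k<n. f x k)"
      unfolding \<phi>_def by (rule suminf_split_initial_segment[OF sm])
    also have "(\<Sum>k<n. f x k) = (\<Sum>k\<in>?S. (1 / 4) ^ Suc k)"
      unfolding f_def by (subst sum.inter_filter[symmetric]) (auto intro!: sum.cong)
    finally have eq: "\<phi> x = (\<Sum>k. f x (k + n)) + (\<Sum>k\<in>?S. (1 / 4) ^ Suc k)" .
    have smn: "summable (\<lambda>k. f x (k + n))" using sm by (rule summable_ignore_initial_segment)
    have "0 \<le> (\<Sum>k. f x (k + n))" using smn nn by (intro suminf_nonneg) auto
    moreover have "(\<Sum>k. f x (k + n)) \<le> (\<Sum>k. (1 / 4) ^ n * (1 / 4) ^ Suc k)"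
      using le[of x "_ + n"] smn sums_summable[OF geo]
      by (intro suminf_le summable_mult) (auto simp: power_add mult_ac)
    moreover have "(\<Sum>k. (1 / 4) ^ n * (1 / 4) ^ Suc k) = (1 / 4 :: real) ^ n * (1 / 3)"
      using sums_mult[OF geo, of "(1 / 4) ^ n"] by (rule sums_unique[symmetric])
    moreover have "(1 / 4 :: real) ^ n * (1 / 3) \<le> (1 / 4) ^ n" by simp
    ultimately show ?thesis unfolding W_def eq by (intro UN_I[of ?S]) auto
  qed
  define Z where "Z = {0..1} \<inter> (\<Inter>n. W n)"
  have Z_sets: "Z \<in> sets lborel" unfolding Z_def using W_sets by (intro sets.Int sets.countable_INT) auto
  show thesis
  proof
    show "inj \<phi>" by fact
    show "Z \<subseteq> {0..1}" by (simp add: Z_def)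
    show "range \<phi> \<subseteq> Z"
    proof
      fix y assume "y \<in> range \<phi>"
      then obtain x where x: "y = \<phi> x" by blast
      have "0 \<le> \<phi> x" unfolding \<phi>_def using sm nn by (intro suminf_nonneg) auto
      moreover have "\<phi> x \<le> (\<Sum>n. (1 / 4) ^ Suc n)"
        unfolding \<phi>_def using sm le sums_summable[OF geo] by (intro suminf_le) auto
      then have "\<phi> x \<le> 1 / 3" using sums_unique[OF geo] by simp
      ultimately show "y \<in> Z" using in_W by (simp add: Z_def x)
    qed
    have "emeasure lborel Z = 0"
    proof (rule ccontr)
      assume nz: "emeasure lborel Z \<noteq> 0"
      have le: "emeasure lborel Z \<le> ennreal ((1 / 2) ^ n)" for n
        using emeasure_mono[of Z "W n" lborel] W_sets W_measure[of n] by (force simp: Z_def intro: order_trans)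
      have fin: "emeasure lborel Z < \<infinity>" using le[of 0] by (simp add: le_less_trans)
      then obtain c where c: "0 \<le> c" "emeasure lborel Z = ennreal c" by (cases "emeasure lborel Z") auto
      then have "0 < c" using nz by (cases "c = 0") auto
      then obtain n where "(1 / 2) ^ n < c" using real_arch_pow_inv[of c "1 / 2"] by auto
      moreover have "c \<le> (1 / 2) ^ n" using le[of n] c by (simp add: ennreal_le_iff)
      ultimately show False by simp
    qed
    then show "Z \<in> null_sets lborel" using Z_sets by (intro null_setsI)
  qed
qed

text \<open>
  The law of \<open>(s, g s)\<close> gives full mass to the graph \<open>{(x, y). y = g x}\<close>, and its first margin is
  Lebesgue measure. The law of \<open>(h t, t)\<close> inherits both properties.
\<close>

lemma left_inverse_and_measure_preserving_if_same_law:
  assumes g: "g \<in> unif \<rightarrow>\<^sub>M unif" and h: "h \<in> unif \<rightarrow>\<^sub>M unif"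
    and eq: "distr unif square_borel (\<lambda>s. (s, g s)) = distr unif square_borel (\<lambda>t. (h t, t))"
  shows "AE t in unif. g (h t) = t"
    and "\<And>B. B \<in> sets unif \<Longrightarrow> emeasure unif (h -` B \<inter> {0..1}) = emeasure unif B"
proof -
  note pg = measurable_pair_square[OF measurable_ident_sets[OF refl] g, unfolded id_def]
  note ph = measurable_pair_square[OF h measurable_ident_sets[OF refl], unfolded id_def]
  have g01: "g s \<in> {0..1}" and h01: "h s \<in> {0..1}" if "s \<in> {0..1}" for s
    using measurable_space[OF g, of s] measurable_space[OF h, of s] that by auto
  have transfer: "emeasure unif {s\<in>{0..1}. (s, g s) \<in> D} = emeasure unif {t\<in>{0..1}. (h t, t) \<in> D}"
    if D: "D \<in> sets square_borel" for D
  proof -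
    have "emeasure (distr unif square_borel (\<lambda>s. (s, g s))) D = emeasure unif ((\<lambda>s. (s, g s)) -` D \<inter> space unif)"
      by (rule emeasure_distr[OF pg D])
    moreover have "emeasure (distr unif square_borel (\<lambda>t. (h t, t))) D = emeasure unif ((\<lambda>t. (h t, t)) -` D \<inter> space unif)"
      by (rule emeasure_distr[OF ph D])
    moreover have "(\<lambda>s. (s, g s)) -` D \<inter> space unif = {s\<in>{0..1}. (s, g s) \<in> D}"
      "(\<lambda>t. (h t, t)) -` D \<inter> space unif = {t\<in>{0..1}. (h t, t) \<in> D}" by auto
    ultimately show ?thesis using eq by simp
  qed
  note fst = measurable_fst_square and snd = measurable_snd_square
  have real: "f \<in> borel_measurable M" if "f \<in> M \<rightarrow>\<^sub>M unif" for f and M :: "(real \<times> real) measure"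
    using that measurable_restrict_space2_iff[of f M lborel "{0..1}"] by simp
  have diag: "{p \<in> space square_borel. f p = k p} \<in> sets square_borel"
    if "f \<in> square_borel \<rightarrow>\<^sub>M unif" "k \<in> square_borel \<rightarrow>\<^sub>M unif" for f k
    using real[OF that(1)] real[OF that(2)] by (rule borel_measurable_eq)
  have full: "AE s in unif. s \<in> A"
    if "A \<in> sets unif" "emeasure unif A = emeasure unif {0..1}" for A
  proof -
    have "emeasure unif ({0..1} - A) = emeasure unif {0..1} - emeasure unif A"
      using that by (intro emeasure_Diff) (auto simp: sets_unif)
    also have "\<dots> = 0" using that by simp
    finally have "{0..1} - A \<in> null_sets unif"
      using that by (intro null_setsI) (auto simp: sets_unif)
    then show ?thesis by (rule AE_I') auto
  qed
  have ph': "{t\<in>{0..1}. (h t, t) \<in> D} \<in> sets unif" if "D \<in> sets square_borel" for D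
  proof -
    have "(\<lambda>t. (h t, t)) -` D \<inter> space unif \<in> sets unif"
      by (rule measurable_sets[OF ph that])
    moreover have "(\<lambda>t. (h t, t)) -` D \<inter> space unif = {t\<in>{0..1}. (h t, t) \<in> D}" by auto
    ultimately show ?thesis by simp
  qed
  let ?G = "{p \<in> space square_borel. snd p = g (fst p)}"
  have G: "?G \<in> sets square_borel" by (rule diag[OF snd measurable_compose[OF fst g]])
  have "(s, g s) \<in> ?G" if "s \<in> {0..1}" for s
    using g01[OF that] that by (simp add: space_square_borel)
  then have "{s\<in>{0..1}. (s, g s) \<in> ?G} = {0..1}" by blast
  then have "AE t in unif. t \<in> {t\<in>{0..1}. (h t, t) \<in> ?G}"
    using transfer[OF G] by (intro full ph'[OF G]) simp
  then show "AE t in unif. g (h t) = t" by eventually_elim auto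
  fix B assume B: "B \<in> sets unif"
  then have B01: "B \<subseteq> {0..1}" by (simp add: sets_unif)
  have "fst -` B \<inter> space square_borel \<in> sets square_borel" by (rule measurable_sets[OF fst B])
  from transfer[OF this] show "emeasure unif (h -` B \<inter> {0..1}) = emeasure unif B"
  proof -
    assume "emeasure unif {s\<in>{0..1}. (s, g s) \<in> fst -` B \<inter> space square_borel} =
      emeasure unif {t\<in>{0..1}. (h t, t) \<in> fst -` B \<inter> space square_borel}"
    moreover have "{s\<in>{0..1}. (s, g s) \<in> fst -` B \<inter> space square_borel} = B"
      using B01 by (simp add: space_square_borel set_eq_iff) (metis atLeastAtMost_iff g01 subsetD)
    moreover have "{t\<in>{0..1}. (h t, t) \<in> fst -` B \<inter> space square_borel} = h -` B \<inter> {0..1}"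
      using B01 by (auto simp: space_square_borel)
    ultimately show ?thesis by simp
  qed
qed

text \<open>
  A Lebesgue measurable set is a Borel set up to a subset of a Borel null set \<open>N'\<close>, and the preimage of
  \<open>N'\<close> under \<open>h\<close> is null. So the preimage of the set under \<open>T\<close> agrees almost everywhere with a Borel set.
\<close>

lemma measure_preserving_01_AE_cong:
  assumes h: "h \<in> unif \<rightarrow>\<^sub>M unif"
    and mp: "\<And>B. B \<in> sets unif \<Longrightarrow> emeasure unif (h -` B \<inter> {0..1}) = emeasure unif B"
    and T: "T \<in> {0..1} \<rightarrow> {0..1}" and eq: "AE t in unif. T t = h t"
  shows "measure_preserving_01 T"
proof -
  have main: "T -` B \<inter> {0..1} \<in> sets lebesgue \<and> emeasure lebesgue (T -` B \<inter> {0..1}) = emeasure lebesgue B"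
    if B: "B \<in> sets lebesgue" "B \<subseteq> {0..1}" for B
  proof -
    obtain S N N' where SN: "B = S \<union> N" "N \<subseteq> N'" "N' \<in> null_sets lborel" "S \<in> sets lborel"
      using B(1) by (rule sets_completionE)
    have S: "S \<in> sets unif" "S \<subseteq> {0..1}" using SN B(2) by (auto simp: sets_unif)
    have N01: "N' \<inter> {0..1} \<in> sets unif" using SN(3) by (auto simp: sets_unif)
    have "h -` (N' \<inter> {0..1}) \<inter> {0..1} \<in> null_sets unif"
    proof (rule null_setsI)
      have "emeasure unif (N' \<inter> {0..1}) = emeasure lborel (N' \<inter> {0..1})" by (intro emeasure_unif) auto
      also have "\<dots> = 0" using null_set_Int2[OF SN(3), of "{0..1}"] by (auto simp: Int_commute)
      finally show "emeasure unif (h -` (N' \<inter> {0..1}) \<inter> {0..1}) = 0" using mp[OF N01] by simp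
      show "h -` (N' \<inter> {0..1}) \<inter> {0..1} \<in> sets unif" using measurable_sets[OF h N01] by simp
    qed
    then have "AE t in unif. t \<notin> h -` (N' \<inter> {0..1}) \<inter> {0..1}" by (rule AE_not_in)
    with eq have "AE t in unif. T t \<in> B \<longleftrightarrow> h t \<in> S" using AE_space
      by eventually_elim (use SN measurable_space[OF h] in auto)
    then have AE: "AE t in lborel. (t \<in> {0..1} \<and> T t \<in> B) = (t \<in> {0..1} \<and> h t \<in> S)"
      unfolding AE_unif_iff by eventually_elim auto
    have E: "h -` S \<inter> {0..1} \<in> sets unif" using measurable_sets[OF h S(1)] by simp
    then have Eb: "h -` S \<inter> {0..1} \<in> sets borel" by (simp add: sets_unif)
    have "{t. t \<in> {0..1} \<and> h t \<in> S} = h -` S \<inter> {0..1}" by auto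
    then have "(\<lambda>t. t \<in> {0..1} \<and> h t \<in> S) \<in> lborel \<rightarrow>\<^sub>M count_space UNIV"
      using Eb by (simp add: pred_def)
    then have "(\<lambda>t. t \<in> {0..1} \<and> T t \<in> B) \<in> completion lborel \<rightarrow>\<^sub>M count_space UNIV"
      by (rule measurable_completion_AE_cong[OF _ _ AE]) auto
    then have "{t \<in> space lebesgue. t \<in> {0..1} \<and> T t \<in> B} \<in> sets lebesgue"
      by (simp add: pred_def)
    moreover have "{t \<in> space lebesgue. t \<in> {0..1} \<and> T t \<in> B} = T -` B \<inter> {0..1}" by auto
    ultimately have TB: "T -` B \<inter> {0..1} \<in> sets lebesgue" by simp
    have "emeasure lebesgue (T -` B \<inter> {0..1}) = emeasure lebesgue (h -` S \<inter> {0..1})"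
    proof (rule emeasure_eq_AE[OF _ TB])
      show "AE t in lebesgue. t \<in> T -` B \<inter> {0..1} \<longleftrightarrow> t \<in> h -` S \<inter> {0..1}"
        using AE_completion[OF AE] by eventually_elim auto
    qed (use Eb in auto)
    also have "\<dots> = emeasure unif (h -` S \<inter> {0..1})" using Eb by (simp add: emeasure_unif)
    also have "\<dots> = emeasure unif S" by (rule mp[OF S(1)])
    also have "\<dots> = emeasure lebesgue S" using S SN(4) by (simp add: emeasure_unif)
    also have "\<dots> = emeasure lebesgue B"
    proof (rule emeasure_eq_AE)
      have "AE t in lborel. t \<notin> N'" using SN(3) by (rule AE_not_in)
      then have "AE t in lebesgue. t \<notin> N'" by (rule AE_completion)
      then show "AE t in lebesgue. t \<in> S \<longleftrightarrow> t \<in> B" by eventually_elim (use SN in auto)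
    qed (use SN B in auto)
    finally show ?thesis using TB by simp
  qed
  show ?thesis
    unfolding measure_preserving_01_def
  proof (intro conjI ballI)
    show "T \<in> lebesgue_on {0..1} \<rightarrow>\<^sub>M lebesgue_on {0..1}"
      by (rule measurableI) (use T main in \<open>auto simp: sets_lebesgue_on_01\<close>)
    fix B :: "real set" assume B: "B \<in> sets (lebesgue_on {0..1})"
    then show "emeasure (lebesgue_on {0..1}) (T -` B \<inter> {0..1}) = emeasure (lebesgue_on {0..1}) B"
      using main[of B] by (simp add: sets_lebesgue_on_01 emeasure_lebesgue_on_01)
  qed
qed

text \<open>
  Where \<open>g (h t) = t\<close>, the function \<open>h\<close> is injective, with image described by \<open>h (g s) = s\<close>. The
  complements of this domain and image may have different cardinalities, so a null set \<open>Z\<close> with the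
  cardinality of the continuum is removed on both sides, together with what \<open>h\<close> and \<open>g\<close> map into it.
  Both complements then contain \<open>Z\<close>, hence they are equipotent, and any bijection between them
  extends \<open>h\<close>.
\<close>

lemma bijective_modification:
  assumes g: "g \<in> unif \<rightarrow>\<^sub>M unif" and h: "h \<in> unif \<rightarrow>\<^sub>M unif"
    and gh: "AE t in unif. g (h t) = t"
    and mp: "\<And>B. B \<in> sets unif \<Longrightarrow> emeasure unif (h -` B \<inter> {0..1}) = emeasure unif B"
  shows "\<exists>T. bij_betw T {0..1} {0..1} \<and> (AE t in unif. T t = h t)"
proof -
  have g01: "g s \<in> {0..1}" and h01: "h s \<in> {0..1}" if "s \<in> {0..1}" for s
    using measurable_space[OF g, of s] measurable_space[OF h, of s] that by auto
  obtain Z :: "real set" and \<phi> :: "real \<Rightarrow> real"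
    where Z: "Z \<in> null_sets lborel" "Z \<subseteq> {0..1}" "inj \<phi>" "range \<phi> \<subseteq> Z"
    by (rule null_set_continuum)
  have Zu: "Z \<in> null_sets unif" using Z(1,2) by (auto simp: null_sets_def sets_unif emeasure_unif)
  have hZ: "h -` Z \<inter> {0..1} \<in> null_sets unif"
    using mp[of Z] Zu measurable_sets[OF h, of Z] by (auto simp: null_sets_def)
  define B where "B = {t\<in>{0..1}. g (h t) = t \<and> t \<notin> Z \<and> h t \<notin> Z}"
  define A where "A = {s\<in>{0..1}. h (g s) = s \<and> s \<notin> Z \<and> g s \<notin> Z}"
  have bij: "bij_betw h B A"
  proof (rule bij_betwI[where g = g])
    show "h \<in> B \<rightarrow> A"
    proof
      fix t assume "t \<in> B"
      then show "h t \<in> A" using h01[of t] by (simp add: A_def B_def)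
    qed
    show "g \<in> A \<rightarrow> B"
    proof
      fix s assume "s \<in> A"
      then show "g s \<in> B" using g01[of s] by (simp add: A_def B_def)
    qed
  qed (auto simp: A_def B_def)
  have "{0..1} - B \<lesssim> {0..1} - A" "{0..1} - A \<lesssim> {0..1} - B"
  proof -
    have "X \<lesssim> Y" if "Z \<subseteq> Y" for X Y :: "real set"
      unfolding lepoll_def using inj_on_subset[OF Z(3) subset_UNIV] Z(4) that by blast
    moreover have "Z \<subseteq> {0..1} - A" "Z \<subseteq> {0..1} - B"
      using Z(2) by (auto simp: A_def B_def)
    ultimately show "{0..1} - B \<lesssim> {0..1} - A" "{0..1} - A \<lesssim> {0..1} - B" by blast+
  qed
  then have "{0..1} - B \<approx> {0..1} - A" by (rule lepoll_antisym)
  then obtain k where k: "bij_betw k ({0..1} - B) ({0..1} - A)" by (auto simp: eqpoll_def)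
  have "bij_betw (\<lambda>t. if t \<in> B then h t else k t) (B \<union> ({0..1} - B)) (A \<union> ({0..1} - A))"
    using bij k by (rule bij_betw_disjoint_Un) auto
  moreover have "B \<union> ({0..1} - B) = {0..1}" "A \<union> ({0..1} - A) = {0..1}" by (auto simp: A_def B_def)
  ultimately have "bij_betw (\<lambda>t. if t \<in> B then h t else k t) {0..1} {0..1}" by simp
  moreover have "AE t in unif. (if t \<in> B then h t else k t) = h t"
    using gh AE_not_in[OF Zu] AE_not_in[OF hZ] AE_space
    by eventually_elim (auto simp: B_def)
  ultimately show ?thesis by blast
qed

lemma shuffle_if_carried_by_graphs:
  assumes C: "is_copula C" and g: "carried_by_graph C g" and h: "carried_by_graph (transposed C) h"
  shows "generalized_shuffle_of_Min C"
proof -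
  have gm: "g \<in> unif \<rightarrow>\<^sub>M unif" and hm: "h \<in> unif \<rightarrow>\<^sub>M unif"
    using g h by (auto simp: carried_by_graph_def)
  have Ch: "copula_measure C = distr unif square_borel (\<lambda>t. (h t, t))"
    by (rule copula_measure_if_transposed_carried_by_graph[OF C h])
  then have eq: "distr unif square_borel (\<lambda>s. (s, g s)) = distr unif square_borel (\<lambda>t. (h t, t))"
    using copula_measure_if_carried_by_graph[OF C g] by simp
  note inv = left_inverse_and_measure_preserving_if_same_law[OF gm hm eq]
  obtain T where T: "bij_betw T {0..1} {0..1}" "AE t in unif. T t = h t"
    using bijective_modification[OF gm hm inv] by blast
  have T01: "T \<in> {0..1} \<rightarrow> {0..1}" using T(1) by (auto simp: bij_betw_def)
  have "measure_preserving_01 T"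
    using hm inv(2) T01 T(2) by (rule measure_preserving_01_AE_cong)
  moreover have "copula_measure C = push_S T (copula_measure min)"
    using push_S_copula_measure_min[OF T01 hm T(2)] Ch by simp
  ultimately show ?thesis
    unfolding generalized_shuffle_of_Min_def using T(1) by blast
qed

theorem theorem4p3:
  fixes C :: "real \<Rightarrow> real \<Rightarrow> real"
  assumes "is_copula C"
  shows "generalized_shuffle_of_Min C \<longleftrightarrow> sobolev_norm C = 1"
proof
  assume sh: "generalized_shuffle_of_Min C"
  obtain g h where g: "carried_by_graph C g" and h: "carried_by_graph (transposed C) h"
    using carried_by_graphs_if_shuffle[OF assms sh] by blast
  show "sobolev_norm C = 1"
    unfolding sobolev_norm_eq_1_iff[OF assms]
    using energy_half_if_carried_by_graph[OF assms g]
      energy_half_if_carried_by_graph[OF copula_transposed[OF assms] h] ..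
next
  assume "sobolev_norm C = 1"
  then have "energy C = 1 / 2" "energy (transposed C) = 1 / 2"
    unfolding sobolev_norm_eq_1_iff[OF assms] by auto
  then obtain g h where "carried_by_graph C g" "carried_by_graph (transposed C) h"
    using carried_by_graph_if_energy_half[OF assms]
      carried_by_graph_if_energy_half[OF copula_transposed[OF assms]] by blast
  then show "generalized_shuffle_of_Min C"
    by (rule shuffle_if_carried_by_graphs[OF assms])
qed

end
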